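(* Let $d\ge2$. Then $$\Big\|\int_{\mathbb R^d}f_0(x-tv,v)\,dv\Big\|_{L_t^{\frac{d+1}{d}}(\mathbb R;L_x^{\frac{d+1}{d-1}}(\mathbb R^d))}\lesssim\|f_0\|_{L^{\frac{d+1}{d},1}_{x,v}(\mathbb R^{2d})}$$ for all $f_0\in L^{\frac{d+1}{d},1}_{x,v}(\mathbb R^{2d})$.
   Context: $L^{q,r}$ is the standard Lorentz space; here $L^{\frac{d+1}{d},1}_{x,v}(\mathbb R^{2d})$ is taken with respect to Lebesgue measure in $(x,v)\in\mathbb R^d\times\mathbb R^d$. The notation $\lesssim$ means $\le$ up to a constant independent of $f_0$. *)

theory Defs
  imports "HOL-Analysis.Analysis"
begin

text \<open>Real powers of extended nonnegative reals; only used with exponent \<open>a > 0\<close>,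
  where \<open>0\<close> is sent to \<open>0\<close> and infinity to infinity.\<close>

definition enn_powr :: "ennreal \<Rightarrow> real \<Rightarrow> ennreal" where
  "enn_powr x a = (if x = top then top else ennreal (enn2real x powr a))"

definition distr_fun :: "'a measure \<Rightarrow> ('a \<Rightarrow> 'b::real_normed_vector) \<Rightarrow> real \<Rightarrow> ennreal" where
  "distr_fun M f s = emeasure M {x \<in> space M. s < norm (f x)}"

text \<open>The Lorentz quasi-norm, for finite exponents \<open>0 < q\<close> and \<open>0 < r\<close>:
  the norm is \<open>q powr (1/r)\<close> times the norm of \<open>s * distr_fun M f s powr (1/q)\<close>
  in \<open>L\<^sup>r\<close> of the half-line with respect to \<open>ds/s\<close>. It coincides with
  the norm of \<open>u powr (1/q) * f\<^sup>* u\<close> in \<open>L\<^sup>r\<close> with respect to \<open>du/u\<close>,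
  where \<open>f\<^sup>*\<close> is the decreasing rearrangement of \<open>f\<close>.\<close>

definition lorentz_norm ::
  "real \<Rightarrow> real \<Rightarrow> 'a measure \<Rightarrow> ('a \<Rightarrow> 'b::real_normed_vector) \<Rightarrow> ennreal" where
  "lorentz_norm q r M f =
     ennreal (q powr (1 / r)) *
     enn_powr (\<integral>\<^sup>+ s \<in> {0<..}.
        (enn_powr (ennreal s * enn_powr (distr_fun M f s) (1 / q)) r / ennreal s) \<partial>lborel) (1 / r)"

definition lorentz_space ::
  "real \<Rightarrow> real \<Rightarrow> 'a measure \<Rightarrow> ('a \<Rightarrow> 'b::real_normed_vector) set" where
  "lorentz_space q r M = {f \<in> borel_measurable M. lorentz_norm q r M f < top}"

definition Lp_norm :: "real \<Rightarrow> 'a measure \<Rightarrow> ('a \<Rightarrow> 'b::real_normed_vector) \<Rightarrow> ennreal" where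
  "Lp_norm p M f = enn_powr (\<integral>\<^sup>+ x. enn_powr (ennreal (norm (f x))) p \<partial>M) (1 / p)"

text \<open>The norm of \<open>L\<^sup>q\<close> in the first variable with values in \<open>L\<^sup>r\<close> in the
  second one. The inner norm may be infinite, so the outer norm is written out for
  \<open>ennreal\<close>-valued functions.\<close>

definition mixed_norm ::
  "real \<Rightarrow> real \<Rightarrow> ('a::euclidean_space \<Rightarrow> 'b::euclidean_space \<Rightarrow> 'c::real_normed_vector) \<Rightarrow> ennreal" where
  "mixed_norm q r F =
     enn_powr (\<integral>\<^sup>+ t. enn_powr (Lp_norm r lebesgue (F t)) q \<partial>lebesgue) (1 / q)"

definition velocity_average ::
  "((real^'d) \<times> (real^'d) \<Rightarrow> complex) \<Rightarrow> real \<Rightarrow> real^'d \<Rightarrow> complex" where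
  "velocity_average f0 t x = (LINT v|lebesgue. f0 (x - t *\<^sub>R v, v))"

end

theory Submission
  imports Defs
begin

text \<open>
  \<^bold>\<open>Why the estimate holds.\<close>  Write \<open>n = d + 1\<close> and let \<open>xray g (x, v)\<close> be the integral of
  \<open>g (t, x + t v)\<close> over \<open>t\<close>.  The operator \<open>xray\<close> is the adjoint of the velocity average
  (\<open>transport_duality\<close>), so the claim is dual to a weak-type bound for \<open>xray\<close> from
  \<open>L\<^sup>n\<close> in \<open>t\<close> with values in \<open>L\<close> to the \<open>n/2\<close> in \<open>x\<close>: the set where \<open>xray g > 1\<close> has measure
  at most a constant times \<open>dual_energy g\<close>, the integral over \<open>t\<close> of the square of the integral
  of \<open>g (t, y)\<close> to the power \<open>n/2\<close> (\<open>xray_weak_type_1\<close>).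

  For a point \<open>z = (x, v)\<close> let \<open>U\<close> be the region under the graph of \<open>t \<mapsto> g (t, x + t v)\<close>, a subset
  of the half-plane with coordinates \<open>(t, \<alpha>)\<close> whose area is \<open>xray g z\<close>.  Squaring the area gives pairs
  of points \<open>(t, \<alpha>)\<close>, \<open>(s, \<beta>)\<close> of \<open>U\<close>.  The dispersive identity \<open>transport_dispersion\<close> says
  that integrating over \<open>z\<close> costs a factor \<open>\<bar>t - s\<bar>\<close> to the power \<open>-d\<close>, which is not integrable near the
  diagonal.  The key point is that the pairs close to the diagonal can be thrown away: if "close"
  means that \<open>\<bar>t - s\<bar>\<close> is at most the number \<open>sep \<alpha> \<beta>\<close>, which is homogeneous of degree \<open>-1\<close>,
  then for \<open>\<beta> \<le> \<alpha>\<close> the close partners of a given point have total area at most a small constant.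
  The close pairs therefore have measure at most half of the area of \<open>U\<close>, whereas all pairs have
  measure equal to the square of the area; if the area exceeds \<open>1\<close>, the far pairs have measure
  at least one half (\<open>far_pairs_ge\<close>).

  It remains to integrate the far pairs over all \<open>z\<close>.  By dispersion this is a bilinear form in
  the distribution function \<open>m (t, \<alpha>)\<close> of \<open>g (t, \<cdot>)\<close>, with the kernel \<open>\<bar>t - s\<bar>\<close> to the power \<open>-d\<close> cut off at
  \<open>sep \<alpha> \<beta>\<close>; the cut-off kernel is integrable in time because \<open>d > 1\<close>.  As \<open>sep \<alpha> \<beta>\<close> weighs
  the smaller height more than the larger one, the kernel decays when \<open>\<alpha> / \<beta>\<close> is far from \<open>1\<close>, and Schur's test with a power weight (\<open>far_schur\<close>)
  leaves the integral of \<open>m\<^sup>2\<close> against \<open>\<alpha>\<close> to the power \<open>d\<close>.  One factor \<open>m\<close> is estimated by Markov's inequality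
  and the other one by the layer-cake formula, and the outcome is \<open>dual_energy g\<close>
  (\<open>distribution_square_moment_le\<close>).

  Scaling, integration over level sets and the layer-cake formula for \<open>f\<^sub>0\<close> turn the weak-type bound into
  \<open>xray_lorentz_dual\<close>, where the Lorentz norm with second index \<open>1\<close> appears because it is
  the integral of the norms of the level sets.  Testing against the extremal function of the
  mixed norm, for truncations of the velocity average so that every quantity is finite, gives
  the mixed-norm estimate (\<open>mixed_power_le_by_duality\<close>).
\<close>

section \<open>Lebesgue integrals on products and of powers\<close>

text \<open>The projections are measurable for the Borel sets of a product without any reference to the
  product sigma-algebra; as measurability rules they apply directly to Lebesgue measure on products,
  which is a measure on the Borel sets of the product type.\<close>

lemma borel_measurable_fst_comp [measurable (raw)]:
  fixes f :: "'c \<Rightarrow> 'a::topological_space \<times> 'b::topological_space"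
  assumes "f \<in> borel_measurable M"
  shows "(\<lambda>x. fst (f x)) \<in> borel_measurable M"
  by (rule measurable_compose[OF assms borel_measurable_continuous_onI]) (intro continuous_intros)

lemma borel_measurable_snd_comp [measurable (raw)]:
  fixes f :: "'c \<Rightarrow> 'a::topological_space \<times> 'b::topological_space"
  assumes "f \<in> borel_measurable M"
  shows "(\<lambda>x. snd (f x)) \<in> borel_measurable M"
  by (rule measurable_compose[OF assms borel_measurable_continuous_onI]) (intro continuous_intros)

lemma nn_integral_lborel_fst:
  fixes f :: "'a::euclidean_space \<times> 'b::euclidean_space \<Rightarrow> ennreal"
  assumes "f \<in> borel_measurable borel"
  shows "(\<integral>\<^sup>+ p. f p \<partial>lborel) = (\<integral>\<^sup>+ x. (\<integral>\<^sup>+ y. f (x, y) \<partial>lborel) \<partial>lborel)"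
  using lborel.nn_integral_fst[of f lborel] assms by (simp add: lborel_prod)

lemma nn_integral_lborel_snd:
  fixes f :: "'a::euclidean_space \<times> 'b::euclidean_space \<Rightarrow> ennreal"
  assumes "f \<in> borel_measurable borel"
  shows "(\<integral>\<^sup>+ p. f p \<partial>lborel) = (\<integral>\<^sup>+ y. (\<integral>\<^sup>+ x. f (x, y) \<partial>lborel) \<partial>lborel)"
  using lborel_pair.nn_integral_snd[of f] assms by (simp add: lborel_prod)

lemma nn_integral_lborel_swap:
  fixes f :: "'a::euclidean_space \<times> 'b::euclidean_space \<Rightarrow> ennreal"
  assumes "f \<in> borel_measurable borel"
  shows "(\<integral>\<^sup>+ x. (\<integral>\<^sup>+ y. f (x, y) \<partial>lborel) \<partial>lborel) = (\<integral>\<^sup>+ y. (\<integral>\<^sup>+ x. f (x, y) \<partial>lborel) \<partial>lborel)"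
  using nn_integral_lborel_fst[OF assms] nn_integral_lborel_snd[OF assms] by simp

lemma nn_integral_powr_upto:
  fixes a e :: real
  assumes "e > -1" "a \<ge> 0"
  shows "(\<integral>\<^sup>+ x. ennreal (x powr e) * indicator {0..a} x \<partial>lborel) = ennreal (a powr (e + 1) / (e + 1))"
  by (rule nn_integral_has_integral_lebesgue'[OF _ has_integral_powr_from_0[OF assms]]) simp

lemma nn_integral_powr_from:
  fixes a e :: real
  assumes "e < -1" "a > 0"
  shows "(\<integral>\<^sup>+ x. ennreal (x powr e) * indicator {a..} x \<partial>lborel) = ennreal (a powr (e + 1) / - (e + 1))"
  using nn_integral_has_integral_lebesgue'[OF _ has_integral_powr_to_inf[OF assms]]
  by (simp add: divide_minus_right del: minus_add_distrib)

section \<open>Close and far pairs of points in the half-plane\<close>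

text \<open>The threshold below which the times of two points at heights \<open>\<alpha>\<close> and \<open>\<beta>\<close> count as close.
  The exponents add up to \<open>-1\<close>, as the scaling \<open>(t, \<alpha>) \<mapsto> (t / r, r \<alpha>)\<close> demands.  The minimum
  carries more than half of this exponent, so that the contribution of far pairs decays when the
  heights differ, but not all of it, so that the close pairs remain summable; the split
  \<open>1/4 + 3/4\<close> is halfway between the two constraints.  The factor \<open>1/32\<close> makes the close
  pairs cost at most half of the area.\<close>

definition sep :: "real \<Rightarrow> real \<Rightarrow> real" where
  "sep \<alpha> \<beta> = max \<alpha> \<beta> powr (-1/4) * min \<alpha> \<beta> powr (-3/4) / 32"

lemma sep_commute: "sep \<alpha> \<beta> = sep \<beta> \<alpha>"
  by (simp add: sep_def max.commute min.commute)

lemma sep_pos: "\<alpha> > 0 \<Longrightarrow> \<beta> > 0 \<Longrightarrow> sep \<alpha> \<beta> > 0"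
  by (simp add: sep_def max_def min_def)

lemma sep_measurable [measurable]:
  assumes [measurable]: "f \<in> borel_measurable M" "g \<in> borel_measurable M"
  shows "(\<lambda>x. sep (f x) (g x)) \<in> borel_measurable M"
  unfolding sep_def by measurable

text \<open>For \<open>\<beta> \<le> \<alpha>\<close> the section at height \<open>\<beta>\<close> is an interval of length
  \<open>\<alpha> powr (-1/4) * \<beta> powr (-3/4) / 16\<close>; the singularity at \<open>\<beta> = 0\<close> is integrable, and by
  homogeneity the powers of \<open>\<alpha>\<close> cancel.\<close>

lemma emeasure_near_le:
  assumes \<alpha>: "\<alpha> > 0"
  shows "emeasure lborel {q :: real \<times> real. 0 < snd q \<and> snd q \<le> \<alpha> \<and> \<bar>t - fst q\<bar> \<le> sep \<alpha> (snd q)} \<le> ennreal (1/4)"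
    (is "emeasure lborel ?S \<le> _")
proof -
  have S [measurable]: "?S \<in> sets borel"
    by measurable
  have "emeasure lborel ?S = (\<integral>\<^sup>+ q. indicator ?S q \<partial>lborel)"
    by simp
  also have "\<dots> = (\<integral>\<^sup>+ \<beta>. (\<integral>\<^sup>+ s. indicator ?S (s, \<beta>) \<partial>lborel) \<partial>lborel)"
    by (rule nn_integral_lborel_snd) simp
  also have "\<dots> \<le> (\<integral>\<^sup>+ \<beta>. ennreal (\<alpha> powr (-1/4) / 16) * (ennreal (\<beta> powr (-3/4)) * indicator {0..\<alpha>} \<beta>) \<partial>lborel)"
  proof (rule nn_integral_mono)
    fix \<beta> :: real
    show "(\<integral>\<^sup>+ s. indicator ?S (s, \<beta>) \<partial>lborel) \<le> ennreal (\<alpha> powr (-1/4) / 16) * (ennreal (\<beta> powr (-3/4)) * indicator {0..\<alpha>} \<beta>)"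
    proof (cases "0 < \<beta> \<and> \<beta> \<le> \<alpha>")
      case True
      then have s: "sep \<alpha> \<beta> = \<alpha> powr (-1/4) * \<beta> powr (-3/4) / 32"
        by (simp add: sep_def max_absorb1 min_absorb2)
      have "(\<integral>\<^sup>+ s. indicator ?S (s, \<beta>) \<partial>lborel) = (\<integral>\<^sup>+ s. indicator {t - sep \<alpha> \<beta> .. t + sep \<alpha> \<beta>} s \<partial>lborel)"
        using True by (intro nn_integral_cong) (auto simp: indicator_def abs_le_iff)
      also have "\<dots> = ennreal (2 * sep \<alpha> \<beta>)"
        using sep_pos[OF \<alpha>, of \<beta>] True by simp
      also have "\<dots> = ennreal (\<alpha> powr (-1/4) / 16) * (ennreal (\<beta> powr (-3/4)) * indicator {0..\<alpha>} \<beta>)"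
        using True by (simp add: s ennreal_mult[symmetric])
      finally show ?thesis by simp
    next
      case False
      then have "indicator ?S (s, \<beta>) = (0 :: ennreal)" for s
        by (auto simp: indicator_def)
      then show ?thesis by simp
    qed
  qed
  also have "\<dots> = ennreal (\<alpha> powr (-1/4) / 16) * ennreal (\<alpha> powr (1/4) / (1/4))"
    using nn_integral_powr_upto[of "-3/4" \<alpha>] \<alpha> by (subst nn_integral_cmult) auto
  also have "\<dots> = ennreal (1/4)"
    using \<alpha> by (simp add: ennreal_mult[symmetric] powr_add[symmetric])
  finally show ?thesis .
qed

text \<open>Each pair is counted at its higher point, whose lower close partners have area at most \<open>1/4\<close>.
  Partners are counted in the whole half-plane, which makes the bound linear and not quadratic in the
  measure of \<open>U\<close>.\<close>

lemma near_pairs_le: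
  fixes U :: "(real \<times> real) set"
  assumes [measurable]: "U \<in> sets borel" and pos: "\<And>p. p \<in> U \<Longrightarrow> snd p > 0"
  shows "(\<integral>\<^sup>+ p. (\<integral>\<^sup>+ q. indicator {(p, q). p \<in> U \<and> q \<in> U \<and> \<bar>fst p - fst q\<bar> \<le> sep (snd p) (snd q)} (p, q) \<partial>lborel) \<partial>lborel)
    \<le> emeasure lborel U * ennreal (1/2)"
proof -
  define S where "S = {(p :: real \<times> real, q :: real \<times> real). p \<in> U \<and> 0 < snd q \<and> snd q \<le> snd p \<and> \<bar>fst p - fst q\<bar> \<le> sep (snd p) (snd q)}"
  have [measurable]: "S \<in> sets borel"
    unfolding S_def case_prod_beta by measurable
  have [measurable]: "(\<lambda>x. indicator S (snd x, fst x) :: ennreal) \<in> borel_measurable borel"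
    by measurable
  have half: "(\<integral>\<^sup>+ p. (\<integral>\<^sup>+ q. indicator S (p, q) \<partial>lborel) \<partial>lborel) \<le> emeasure lborel U * ennreal (1/4)"
  proof -
    have "(\<integral>\<^sup>+ q. indicator S (p, q) \<partial>lborel) \<le> indicator U p * ennreal (1/4)" for p :: "real \<times> real"
    proof (cases "p \<in> U")
      case True
      have "(\<integral>\<^sup>+ q. indicator S (p, q) \<partial>lborel) = (\<integral>\<^sup>+ q. indicator {q :: real \<times> real. 0 < snd q \<and> snd q \<le> snd p \<and> \<bar>fst p - fst q\<bar> \<le> sep (snd p) (snd q)} q \<partial>lborel)"
        using True by (intro nn_integral_cong) (auto simp: indicator_def S_def)
      also have "\<dots> \<le> ennreal (1/4)"
        using emeasure_near_le[OF pos[OF True], of "fst p"] by (subst nn_integral_indicator) auto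
      finally show ?thesis using True by simp
    qed (simp add: S_def)
    then have "(\<integral>\<^sup>+ p. (\<integral>\<^sup>+ q. indicator S (p, q) \<partial>lborel) \<partial>lborel) \<le> (\<integral>\<^sup>+ p. indicator U p * ennreal (1/4) \<partial>lborel)"
      by (rule nn_integral_mono)
    also have "\<dots> = emeasure lborel U * ennreal (1/4)"
      by (subst nn_integral_multc) auto
    finally show ?thesis .
  qed
  have "(\<integral>\<^sup>+ p. (\<integral>\<^sup>+ q. indicator {(p, q). p \<in> U \<and> q \<in> U \<and> \<bar>fst p - fst q\<bar> \<le> sep (snd p) (snd q)} (p, q) \<partial>lborel) \<partial>lborel)
    \<le> (\<integral>\<^sup>+ p. (\<integral>\<^sup>+ q. indicator S (p, q) + indicator S (q, p) \<partial>lborel) \<partial>lborel)"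
    using pos by (intro nn_integral_mono) (auto simp: indicator_def S_def sep_commute abs_minus_commute)
  also have "\<dots> = (\<integral>\<^sup>+ p. (\<integral>\<^sup>+ q. indicator S (p, q) \<partial>lborel) \<partial>lborel) + (\<integral>\<^sup>+ p. (\<integral>\<^sup>+ q. indicator S (q, p) \<partial>lborel) \<partial>lborel)"
    by (simp add: nn_integral_add)
  also have "(\<integral>\<^sup>+ p. (\<integral>\<^sup>+ q. indicator S (q, p) \<partial>lborel) \<partial>lborel) = (\<integral>\<^sup>+ p. (\<integral>\<^sup>+ q. indicator S (p, q) \<partial>lborel) \<partial>lborel)"
    using nn_integral_lborel_swap[of "indicator S"] by simp
  also have "(\<integral>\<^sup>+ p. (\<integral>\<^sup>+ q. indicator S (p, q) \<partial>lborel) \<partial>lborel) + (\<integral>\<^sup>+ p. (\<integral>\<^sup>+ q. indicator S (p, q) \<partial>lborel) \<partial>lborel)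
      \<le> emeasure lborel U * ennreal (1/4) + emeasure lborel U * ennreal (1/4)"
    by (intro add_mono half)
  also have "\<dots> = emeasure lborel U * (ennreal (1/4) + ennreal (1/4))"
    by (simp add: distrib_left)
  also have "ennreal (1/4) + ennreal (1/4) = ennreal (1/2)"
    by (subst ennreal_plus[symmetric]) auto
  finally show ?thesis .
qed

definition far :: "(real \<times> real) \<times> (real \<times> real) \<Rightarrow> bool" where
  "far pq = (\<bar>fst (fst pq) - fst (snd pq)\<bar> > sep (snd (fst pq)) (snd (snd pq)))"

lemma far_measurable [measurable]: "Measurable.pred borel far"
  unfolding far_def by measurable

text \<open>The quadratic count of all pairs beats the linear bound for the close pairs.  The subtraction
  needs finite measure, so it is done for a bounded part of \<open>U\<close> whose measure still exceeds
  \<open>1\<close>.\<close>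

lemma far_pairs_ge:
  fixes U :: "(real \<times> real) set"
  assumes U [measurable]: "U \<in> sets borel" and pos: "\<And>p. p \<in> U \<Longrightarrow> snd p > 0"
    and gt: "emeasure lborel U > 1"
  shows "1 \<le> 2 * (\<integral>\<^sup>+ p. (\<integral>\<^sup>+ q. indicator {pq. fst pq \<in> U \<and> snd pq \<in> U \<and> far pq} (p, q) \<partial>lborel) \<partial>lborel)"
proof -
  (* Exhaust U by bounded pieces; one of them already has measure greater than 1. *)
  define V where "V k = U \<inter> cbox (- real k, - real k) (real k, real k)" for k :: nat
  have V [measurable]: "V k \<in> sets borel" for k
    by (simp add: V_def)
  have "incseq V"
    by (auto simp: V_def incseq_def cbox_Pair_eq)
  moreover have "(\<Union>k. V k) = U"
  proof -
    have "\<exists>k. p \<in> cbox (- real k, - real k) (real k, real k)" for p :: "real \<times> real"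
    proof -
      obtain k where "max \<bar>fst p\<bar> \<bar>snd p\<bar> \<le> real k"
        using real_arch_simple by blast
      then show ?thesis
        by (intro exI[of _ k]) (cases p; auto simp: cbox_Pair_eq)
    qed
    then show ?thesis by (auto simp: V_def)
  qed
  ultimately have "(\<lambda>k. emeasure lborel (V k)) \<longlonglongrightarrow> emeasure lborel U"
    using Lim_emeasure_incseq[of V lborel] by (simp add: image_subset_iff)
  then have "eventually (\<lambda>k. emeasure lborel (V k) > 1) sequentially"
    using gt by (rule order_tendstoD)
  then obtain k where k: "emeasure lborel (V k) > 1"
    by (auto simp: eventually_sequentially)
  define W where "W = V k"
  have W [measurable]: "W \<in> sets borel" by (simp add: W_def)
  have WU: "W \<subseteq> U" by (auto simp: W_def V_def)
  have "emeasure lborel W \<le> emeasure lborel (cbox (- real k, - real k) (real k, real k))"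
    by (intro emeasure_mono) (auto simp: W_def V_def)
  also have "\<dots> < \<infinity>"
    by (rule emeasure_lborel_cbox_finite)
  finally have "emeasure lborel W < top"
    by simp
  then obtain w where w: "emeasure lborel W = ennreal w" "w \<ge> 0"
    by (metis ennreal_cases less_top)
  have w1: "w > 1"
    using k w by (simp add: W_def)
  define N F where "N = {pq. fst pq \<in> W \<and> snd pq \<in> W \<and> \<not> far pq}"
    and "F = {pq. fst pq \<in> W \<and> snd pq \<in> W \<and> far pq}"
  have [measurable]: "N \<in> sets borel" "F \<in> sets borel"
    unfolding N_def F_def by measurable
  define n f where "n = (\<integral>\<^sup>+ p. (\<integral>\<^sup>+ q. indicator N (p, q) \<partial>lborel) \<partial>lborel)"
    and "f = (\<integral>\<^sup>+ p. (\<integral>\<^sup>+ q. indicator F (p, q) \<partial>lborel) \<partial>lborel)"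
  have "N = {(p, q). p \<in> W \<and> q \<in> W \<and> \<bar>fst p - fst q\<bar> \<le> sep (snd p) (snd q)}"
    by (auto simp: N_def far_def)
  then have "n \<le> ennreal w * ennreal (1/2)"
    using near_pairs_le[of W] pos WU by (auto simp: n_def w)
  also have "\<dots> = ennreal (w / 2)"
    using w by (subst ennreal_mult[symmetric]) auto
  finally have n: "n \<le> ennreal (w / 2)" .
  have "ennreal w * ennreal w = (\<integral>\<^sup>+ p. (\<integral>\<^sup>+ q. indicator W p * indicator W q \<partial>lborel) \<partial>lborel)"
    by (simp add: nn_integral_cmult nn_integral_multc w)
  also have "\<dots> = (\<integral>\<^sup>+ p. (\<integral>\<^sup>+ q. indicator N (p, q) + indicator F (p, q) \<partial>lborel) \<partial>lborel)"
    by (intro nn_integral_cong) (auto simp: indicator_def N_def F_def)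
  also have "\<dots> = n + f"
    by (simp add: nn_integral_add n_def f_def)
  finally have nf: "ennreal (w * w) = n + f"
    using w by (simp add: ennreal_mult)
  have "f \<le> (\<integral>\<^sup>+ p. (\<integral>\<^sup>+ q. indicator {pq. fst pq \<in> U \<and> snd pq \<in> U \<and> far pq} (p, q) \<partial>lborel) \<partial>lborel)"
    unfolding f_def F_def using WU by (intro nn_integral_mono) (auto simp: indicator_def)
  moreover have "1 \<le> 2 * f"
  proof (cases f)
    case (real r)
    have "n < top" using n by (simp add: order.strict_trans1)
    then obtain m where m: "n = ennreal m" "m \<ge> 0"
      by (metis ennreal_cases less_top)
    have "w * w = m + r" "m \<le> w / 2"
      using nf n m real w w1 by (auto simp: ennreal_plus[symmetric] simp del: ennreal_plus)
    moreover have "w * w \<ge> w" using w1 by (simp add: mult_le_cancel_left1)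
    ultimately have "1 \<le> 2 * r" using w1 by linarith
    then show ?thesis using real by (simp add: ennreal_numeral[symmetric] ennreal_mult[symmetric] ennreal_1[symmetric] del: ennreal_numeral ennreal_1)
  qed (simp add: ennreal_mult_top)
  ultimately show ?thesis
    by (meson dual_order.trans mult_left_mono zero_le)
qed

section \<open>Dispersion of free transport\<close>

lemma nn_integral_lborel_affine:
  fixes f :: "'a::euclidean_space \<Rightarrow> ennreal"
  assumes [measurable]: "f \<in> borel_measurable borel" and c: "c \<noteq> 0"
  shows "(\<integral>\<^sup>+ x. f x \<partial>lborel) = ennreal (\<bar>c\<bar> ^ DIM('a)) * (\<integral>\<^sup>+ x. f (t + c *\<^sub>R x) \<partial>lborel)"
proof -
  have "(\<integral>\<^sup>+ x. f x \<partial>lborel) = (\<integral>\<^sup>+ x. f x \<partial>(density (distr lborel borel (\<lambda>x. t + c *\<^sub>R x)) (\<lambda>_. \<bar>c\<bar> ^ DIM('a))))"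
    using lborel_affine[OF c, of t] by simp
  also have "\<dots> = ennreal (\<bar>c\<bar> ^ DIM('a)) * (\<integral>\<^sup>+ x. f (t + c *\<^sub>R x) \<partial>lborel)"
    by (simp add: nn_integral_density nn_integral_distr nn_integral_cmult)
  finally show ?thesis .
qed

lemma nn_integral_lborel_translate:
  fixes f :: "'a::euclidean_space \<Rightarrow> ennreal"
  assumes "f \<in> borel_measurable borel"
  shows "(\<integral>\<^sup>+ x. f (x + t) \<partial>lborel) = (\<integral>\<^sup>+ x. f x \<partial>lborel)"
  using nn_integral_lborel_affine[OF assms, of 1 t] by (simp add: add.commute)

text \<open>The dispersive identity of free transport: for fixed \<open>y = x + t v\<close> the point \<open>x + s v\<close> is
  \<open>y + (s - t) v\<close>, so the integral over \<open>v\<close> is a dilation by \<open>s - t\<close>.\<close>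

lemma transport_dispersion:
  fixes A B :: "'a::euclidean_space set"
  assumes [measurable]: "A \<in> sets borel" "B \<in> sets borel" and ts: "t \<noteq> s"
  shows "(\<integral>\<^sup>+ z. indicator A (fst z + t *\<^sub>R snd z) * indicator B (fst z + s *\<^sub>R snd z) \<partial>lborel)
    = ennreal (\<bar>t - s\<bar> powr - real DIM('a)) * (emeasure lborel A * emeasure lborel B)"
proof -
  define c where "c = \<bar>t - s\<bar> powr - real DIM('a)"
  have inner: "(\<integral>\<^sup>+ v. indicator B (y + (s - t) *\<^sub>R v) \<partial>lborel) = ennreal c * emeasure lborel B" for y :: 'a
  proof -
    have "emeasure lborel B = (\<integral>\<^sup>+ v. indicator B v \<partial>lborel)"
      by simp
    also have "\<dots> = ennreal (\<bar>s - t\<bar> ^ DIM('a)) * (\<integral>\<^sup>+ v. indicator B (y + (s - t) *\<^sub>R v) \<partial>lborel)"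
      using ts by (intro nn_integral_lborel_affine) auto
    finally have "ennreal c * emeasure lborel B = ennreal c * ennreal (\<bar>s - t\<bar> ^ DIM('a)) * (\<integral>\<^sup>+ v. indicator B (y + (s - t) *\<^sub>R v) \<partial>lborel)"
      by (simp add: mult.assoc)
    also have "ennreal c * ennreal (\<bar>s - t\<bar> ^ DIM('a)) = 1"
      using ts by (simp add: c_def ennreal_mult[symmetric] powr_minus powr_realpow abs_minus_commute)
    finally show ?thesis by simp
  qed
  have "(\<integral>\<^sup>+ z. indicator A (fst z + t *\<^sub>R snd z) * indicator B (fst z + s *\<^sub>R snd z) \<partial>lborel)
     = (\<integral>\<^sup>+ v. (\<integral>\<^sup>+ x. indicator A (x + t *\<^sub>R v) * indicator B (x + s *\<^sub>R v) \<partial>lborel) \<partial>lborel)"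
    by (subst nn_integral_lborel_snd) simp_all
  also have "\<dots> = (\<integral>\<^sup>+ v. (\<integral>\<^sup>+ y. indicator A y * indicator B (y + (s - t) *\<^sub>R v) \<partial>lborel) \<partial>lborel)"
  proof (rule nn_integral_cong)
    fix v :: 'a
    have "(\<integral>\<^sup>+ x. indicator A (x + t *\<^sub>R v) * indicator B ((x + t *\<^sub>R v) + (s - t) *\<^sub>R v) \<partial>lborel)
        = (\<integral>\<^sup>+ y. indicator A y * indicator B (y + (s - t) *\<^sub>R v) \<partial>lborel)"
      by (rule nn_integral_lborel_translate[where f = "\<lambda>y. indicator A y * indicator B (y + (s - t) *\<^sub>R v)"]) measurable
    then show "(\<integral>\<^sup>+ x. indicator A (x + t *\<^sub>R v) * indicator B (x + s *\<^sub>R v) \<partial>lborel)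
        = (\<integral>\<^sup>+ y. indicator A y * indicator B (y + (s - t) *\<^sub>R v) \<partial>lborel)"
      by (simp add: algebra_simps)
  qed
  also have "\<dots> = (\<integral>\<^sup>+ y. (\<integral>\<^sup>+ v. indicator A y * indicator B (y + (s - t) *\<^sub>R v) \<partial>lborel) \<partial>lborel)"
    using nn_integral_lborel_swap[of "\<lambda>p. indicator A (fst p) * indicator B (fst p + (s - t) *\<^sub>R snd p) :: ennreal"]
    by simp
  also have "\<dots> = (\<integral>\<^sup>+ y. indicator A y * (ennreal c * emeasure lborel B) \<partial>lborel)"
    by (simp add: nn_integral_cmult inner)
  also have "\<dots> = ennreal c * (emeasure lborel A * emeasure lborel B)"
    by (simp add: nn_integral_multc) (simp add: mult_ac)
  finally show ?thesis by (simp add: c_def)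
qed

section \<open>Schur's test for the far kernel\<close>

lemma nn_integral_powr_away_le:
  fixes D \<delta> t :: real
  assumes D: "D > 1" and \<delta>: "\<delta> > 0"
  shows "(\<integral>\<^sup>+ s. ennreal (\<bar>t - s\<bar> powr - D) * indicator {s. \<delta> < \<bar>t - s\<bar>} s \<partial>lborel) \<le> ennreal (2 / (D - 1) * \<delta> powr (1 - D))"
proof -
  define f where "f s = ennreal (\<bar>t - s\<bar> powr - D) * indicator {s. \<delta> \<le> s - t} s" for s
  define g where "g s = ennreal (\<bar>t - s\<bar> powr - D) * indicator {s. \<delta> \<le> t - s} s" for s
  have [measurable]: "f \<in> borel_measurable borel" "g \<in> borel_measurable borel"
    unfolding f_def g_def by measurable
  have "(\<integral>\<^sup>+ s. f s \<partial>lborel) = (\<integral>\<^sup>+ x. f (t + 1 *\<^sub>R x) \<partial>lborel)"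
    by (subst nn_integral_lborel_affine[of _ 1 t]) simp_all
  also have "\<dots> = (\<integral>\<^sup>+ x. ennreal (x powr - D) * indicator {\<delta>..} x \<partial>lborel)"
    using \<delta> by (intro nn_integral_cong) (auto simp: f_def indicator_def)
  finally have f: "(\<integral>\<^sup>+ s. f s \<partial>lborel) = ennreal (\<delta> powr (1 - D) / (D - 1))"
    using nn_integral_powr_from[of "- D" \<delta>] D \<delta> by simp
  have "(\<integral>\<^sup>+ s. g s \<partial>lborel) = (\<integral>\<^sup>+ x. g (t + (-1) *\<^sub>R x) \<partial>lborel)"
    by (subst nn_integral_lborel_affine[of _ "-1" t]) simp_all
  also have "\<dots> = (\<integral>\<^sup>+ x. ennreal (x powr - D) * indicator {\<delta>..} x \<partial>lborel)"
    using \<delta> by (intro nn_integral_cong) (auto simp: g_def indicator_def)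
  finally have g: "(\<integral>\<^sup>+ s. g s \<partial>lborel) = ennreal (\<delta> powr (1 - D) / (D - 1))"
    using nn_integral_powr_from[of "- D" \<delta>] D \<delta> by simp
  have "(\<integral>\<^sup>+ s. ennreal (\<bar>t - s\<bar> powr - D) * indicator {s. \<delta> < \<bar>t - s\<bar>} s \<partial>lborel) \<le> (\<integral>\<^sup>+ s. f s + g s \<partial>lborel)"
    by (intro nn_integral_mono) (auto simp: f_def g_def indicator_def)
  also have "\<dots> = ennreal (2 / (D - 1) * \<delta> powr (1 - D))"
    using D by (simp add: nn_integral_add f g ennreal_plus[symmetric] add_divide_distrib[symmetric] del: ennreal_plus)
  finally show ?thesis .
qed

lemma sep_powr:
  assumes "0 < \<beta>" "\<beta> \<le> \<alpha>"
  shows "sep \<alpha> \<beta> powr e = \<alpha> powr (- e / 4) * \<beta> powr (- 3 * e / 4) * 32 powr - e"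
proof -
  have "sep \<alpha> \<beta> = \<alpha> powr (-1/4) * \<beta> powr (-3/4) / 32"
    using assms by (simp add: sep_def max_absorb1 min_absorb2)
  then have "sep \<alpha> \<beta> powr e = (\<alpha> powr (-1/4)) powr e * (\<beta> powr (-3/4)) powr e / 32 powr e"
    by (simp only: powr_mult powr_divide powr_ge_zero mult_nonneg_nonneg zero_le_numeral)
  also have "\<dots> = \<alpha> powr (- e / 4) * \<beta> powr (- 3 * e / 4) * 32 powr - e"
    by (simp only: powr_powr) (simp add: powr_minus_divide)
  finally show ?thesis .
qed

definition far_const :: "real \<Rightarrow> real" where
  "far_const D = 16 * 32 powr (D - 1) / (D - 1)\<^sup>2"

text \<open>The row sums for Schur's test.  Integrating in \<open>s\<close> leaves \<open>sep \<alpha> \<beta>\<close> to the power \<open>1 - D\<close>,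
  that is, the larger height to the power \<open>(D - 1)/4\<close> times the smaller one to the power \<open>3(D - 1)/4\<close>.  The
  weight exponent \<open>(D + 1)/2\<close> is the midpoint of the window between \<open>(D - 1)/4 + 1\<close> and \<open>3(D - 1)/4 + 1\<close> 
  in which the \<open>\<beta>\<close>-integral converges both at \<open>0\<close> and at infinity.\<close>

lemma nn_integral_far_kernel_le:
  fixes D \<alpha> t :: real
  assumes D: "D > 1" and \<alpha>: "\<alpha> > 0"
  shows "(\<integral>\<^sup>+ q. ennreal (\<bar>t - fst q\<bar> powr - D * (\<alpha> / snd q) powr ((D + 1) / 2)) *
      indicator {q. 0 < snd q \<and> far ((t, \<alpha>), q)} q \<partial>lborel) \<le> ennreal (far_const D * \<alpha> powr D)"
proof -
  define \<sigma> where "\<sigma> = (D + 1) / 2"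
  define K where "K = 2 / (D - 1) * 32 powr (D - 1)"
  have K: "K > 0" using D by (simp add: K_def)
  have exps: "3 * (D - 1) / 4 + - \<sigma> = (D - 5) / 4" "(D - 1) / 4 + - \<sigma> = (- D - 3) / 4"
    "(D - 1) / 4 + \<sigma> + (D - 1) / 4 = D" "3 * (D - 1) / 4 + \<sigma> + - ((D - 1) / 4) = D"
    by (simp_all add: \<sigma>_def field_simps)
  have [measurable]: "Measurable.pred borel (\<lambda>q :: real \<times> real. far ((t, \<alpha>), q))"
    unfolding far_def by measurable
  have "(\<integral>\<^sup>+ q. ennreal (\<bar>t - fst q\<bar> powr - D * (\<alpha> / snd q) powr ((D + 1) / 2)) *
      indicator {q. 0 < snd q \<and> far ((t, \<alpha>), q)} q \<partial>lborel)
    = (\<integral>\<^sup>+ \<beta>. (\<integral>\<^sup>+ s. ennreal (\<bar>t - s\<bar> powr - D * (\<alpha> / \<beta>) powr \<sigma>) *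
      indicator {q. 0 < snd q \<and> far ((t, \<alpha>), q)} (s, \<beta>) \<partial>lborel) \<partial>lborel)"
    by (subst nn_integral_lborel_snd) (simp_all add: \<sigma>_def)
  also have "\<dots> \<le> (\<integral>\<^sup>+ \<beta>. ennreal (K * \<alpha> powr ((D - 1) / 4 + \<sigma>)) * (ennreal (\<beta> powr ((D - 5) / 4)) * indicator {0..\<alpha>} \<beta>)
      + ennreal (K * \<alpha> powr (3 * (D - 1) / 4 + \<sigma>)) * (ennreal (\<beta> powr ((- D - 3) / 4)) * indicator {\<alpha>..} \<beta>) \<partial>lborel)"
  proof (rule nn_integral_mono)
    fix \<beta> :: real
    show "(\<integral>\<^sup>+ s. ennreal (\<bar>t - s\<bar> powr - D * (\<alpha> / \<beta>) powr \<sigma>) *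
        indicator {q. 0 < snd q \<and> far ((t, \<alpha>), q)} (s, \<beta>) \<partial>lborel)
      \<le> ennreal (K * \<alpha> powr ((D - 1) / 4 + \<sigma>)) * (ennreal (\<beta> powr ((D - 5) / 4)) * indicator {0..\<alpha>} \<beta>)
      + ennreal (K * \<alpha> powr (3 * (D - 1) / 4 + \<sigma>)) * (ennreal (\<beta> powr ((- D - 3) / 4)) * indicator {\<alpha>..} \<beta>)"
    proof (cases "\<beta> > 0")
      case True
      have ratio: "(\<alpha> / \<beta>) powr \<sigma> = \<alpha> powr \<sigma> * \<beta> powr - \<sigma>"
        using \<alpha> True by (simp add: powr_divide powr_minus_divide)
      have "(\<integral>\<^sup>+ s. ennreal (\<bar>t - s\<bar> powr - D * (\<alpha> / \<beta>) powr \<sigma>) *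
          indicator {q. 0 < snd q \<and> far ((t, \<alpha>), q)} (s, \<beta>) \<partial>lborel)
        = (\<integral>\<^sup>+ s. ennreal ((\<alpha> / \<beta>) powr \<sigma>) * (ennreal (\<bar>t - s\<bar> powr - D) * indicator {s. sep \<alpha> \<beta> < \<bar>t - s\<bar>} s) \<partial>lborel)"
        using True by (intro nn_integral_cong) (auto simp: far_def indicator_def ennreal_mult mult_ac)
      also have "\<dots> = ennreal ((\<alpha> / \<beta>) powr \<sigma>) * (\<integral>\<^sup>+ s. ennreal (\<bar>t - s\<bar> powr - D) * indicator {s. sep \<alpha> \<beta> < \<bar>t - s\<bar>} s \<partial>lborel)"
        by (rule nn_integral_cmult) measurable
      also have "\<dots> \<le> ennreal ((\<alpha> / \<beta>) powr \<sigma>) * ennreal (2 / (D - 1) * sep \<alpha> \<beta> powr (1 - D))"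
        by (intro mult_left_mono nn_integral_powr_away_le D sep_pos \<alpha> True) simp
      also have "\<dots> = ennreal ((\<alpha> / \<beta>) powr \<sigma> * (2 / (D - 1) * sep \<alpha> \<beta> powr (1 - D)))"
        using D by (intro ennreal_mult[symmetric]) auto
      also have "\<dots> \<le> ennreal (K * \<alpha> powr ((D - 1) / 4 + \<sigma>)) * (ennreal (\<beta> powr ((D - 5) / 4)) * indicator {0..\<alpha>} \<beta>)
        + ennreal (K * \<alpha> powr (3 * (D - 1) / 4 + \<sigma>)) * (ennreal (\<beta> powr ((- D - 3) / 4)) * indicator {\<alpha>..} \<beta>)"
      proof (cases "\<beta> \<le> \<alpha>")
        case le: True
        have "sep \<alpha> \<beta> powr (1 - D) = \<alpha> powr ((D - 1) / 4) * \<beta> powr (3 * (D - 1) / 4) * 32 powr (D - 1)"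
          using sep_powr[of \<beta> \<alpha> "1 - D"] True le by (simp add: algebra_simps)
        then have "(\<alpha> / \<beta>) powr \<sigma> * (2 / (D - 1) * sep \<alpha> \<beta> powr (1 - D)) =
           K * (\<alpha> powr ((D - 1) / 4) * \<alpha> powr \<sigma>) * (\<beta> powr (3 * (D - 1) / 4) * \<beta> powr - \<sigma>)"
          by (simp add: K_def ratio)
        also have "\<dots> = K * \<alpha> powr ((D - 1) / 4 + \<sigma>) * \<beta> powr ((D - 5) / 4)"
          by (simp only: powr_add[symmetric] exps)
        finally have "ennreal ((\<alpha> / \<beta>) powr \<sigma> * (2 / (D - 1) * sep \<alpha> \<beta> powr (1 - D))) =
          ennreal (K * \<alpha> powr ((D - 1) / 4 + \<sigma>)) * (ennreal (\<beta> powr ((D - 5) / 4)) * indicator {0..\<alpha>} \<beta>)"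
          using le True K by (simp add: ennreal_mult)
        then show ?thesis by (simp add: add_increasing2)
      next
        case gt: False
        have "sep \<alpha> \<beta> powr (1 - D) = \<beta> powr ((D - 1) / 4) * \<alpha> powr (3 * (D - 1) / 4) * 32 powr (D - 1)"
          using sep_powr[of \<alpha> \<beta> "1 - D"] \<alpha> gt by (simp add: algebra_simps sep_commute)
        then have "(\<alpha> / \<beta>) powr \<sigma> * (2 / (D - 1) * sep \<alpha> \<beta> powr (1 - D)) =
           K * (\<alpha> powr (3 * (D - 1) / 4) * \<alpha> powr \<sigma>) * (\<beta> powr ((D - 1) / 4) * \<beta> powr - \<sigma>)"
          by (simp add: K_def ratio)
        also have "\<dots> = K * \<alpha> powr (3 * (D - 1) / 4 + \<sigma>) * \<beta> powr ((- D - 3) / 4)"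
          by (simp only: powr_add[symmetric] exps)
        finally have "ennreal ((\<alpha> / \<beta>) powr \<sigma> * (2 / (D - 1) * sep \<alpha> \<beta> powr (1 - D))) =
          ennreal (K * \<alpha> powr (3 * (D - 1) / 4 + \<sigma>)) * (ennreal (\<beta> powr ((- D - 3) / 4)) * indicator {\<alpha>..} \<beta>)"
          using gt True K by (simp add: ennreal_mult)
        then show ?thesis by (simp add: add_increasing)
      qed
      finally show ?thesis .
    qed simp
  qed
  also have "\<dots> = ennreal (K * \<alpha> powr ((D - 1) / 4 + \<sigma>)) * ennreal (\<alpha> powr ((D - 1) / 4) / ((D - 1) / 4))
      + ennreal (K * \<alpha> powr (3 * (D - 1) / 4 + \<sigma>)) * ennreal (\<alpha> powr (- ((D - 1) / 4)) / ((D - 1) / 4))"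
  proof -
    have "(D - 5) / 4 + 1 = (D - 1) / 4" "(- D - 3) / 4 + 1 = - ((D - 1) / 4)"
      by (simp_all add: field_simps)
    then have "(\<integral>\<^sup>+ \<beta>. ennreal (\<beta> powr ((D - 5) / 4)) * indicator {0..\<alpha>} \<beta> \<partial>lborel) = ennreal (\<alpha> powr ((D - 1) / 4) / ((D - 1) / 4))"
      "(\<integral>\<^sup>+ \<beta>. ennreal (\<beta> powr ((- D - 3) / 4)) * indicator {\<alpha>..} \<beta> \<partial>lborel) = ennreal (\<alpha> powr (- ((D - 1) / 4)) / ((D - 1) / 4))"
      using nn_integral_powr_upto[of "(D - 5) / 4" \<alpha>] nn_integral_powr_from[of "(- D - 3) / 4" \<alpha>] D \<alpha>
      by (simp_all only: minus_minus) (simp_all add: field_simps)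
    then show ?thesis
      by (simp add: nn_integral_add nn_integral_cmult)
  qed
  also have "\<dots> = ennreal (K * (4 / (D - 1)) * (\<alpha> powr ((D - 1) / 4 + \<sigma>) * \<alpha> powr ((D - 1) / 4)
      + \<alpha> powr (3 * (D - 1) / 4 + \<sigma>) * \<alpha> powr (- ((D - 1) / 4))))"
    using D K by (simp add: ennreal_mult[symmetric] ennreal_plus[symmetric] distrib_left add_divide_distrib mult_ac del: ennreal_plus)
  also have "\<alpha> powr ((D - 1) / 4 + \<sigma>) * \<alpha> powr ((D - 1) / 4) = \<alpha> powr D"
    by (simp only: powr_add[symmetric] exps)
  also have "\<alpha> powr (3 * (D - 1) / 4 + \<sigma>) * \<alpha> powr (- ((D - 1) / 4)) = \<alpha> powr D"
    by (simp only: powr_add[symmetric] exps)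
  also have "K * (4 / (D - 1)) * (\<alpha> powr D + \<alpha> powr D) = far_const D * \<alpha> powr D"
    using D by (simp add: K_def far_const_def field_simps power2_eq_square)
  finally show ?thesis .
qed

text \<open>Weighted arithmetic-geometric means up to a factor \<open>2\<close>, in a form that holds for infinite
  values as well: compare \<open>y\<close> with \<open>w x\<close>.\<close>

lemma ennreal_mult_le_weighted_squares:
  fixes x y :: ennreal and w :: real
  assumes w: "w > 0"
  shows "x * y \<le> ennreal w * x\<^sup>2 + ennreal (1 / w) * y\<^sup>2"
proof (cases "y \<le> ennreal w * x")
  case True
  then have "x * y \<le> x * (ennreal w * x)"
    by (intro mult_left_mono) auto
  also have "\<dots> = ennreal w * x\<^sup>2"
    by (simp add: power2_eq_square mult_ac)
  finally show ?thesis
    by (rule order_trans) simp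
next
  case False
  have "x = ennreal (1 / w) * (ennreal w * x)"
    using w by (simp add: mult.assoc[symmetric] ennreal_mult[symmetric])
  also have "\<dots> \<le> ennreal (1 / w) * y"
    using False by (intro mult_left_mono) auto
  finally have "x * y \<le> ennreal (1 / w) * y * y"
    by (intro mult_right_mono) auto
  also have "\<dots> = ennreal (1 / w) * y\<^sup>2"
    by (simp add: power2_eq_square mult_ac)
  finally show ?thesis
    by (rule order_trans) simp
qed

lemma far_const_nonneg: "far_const D \<ge> 0"
  by (simp add: far_const_def)

text \<open>Schur's test with the weight \<open>(\<alpha> / \<beta>) powr ((D + 1) / 2)\<close>.  The kernel is symmetric and exchanging
  the two points inverts the weight, so both squares contribute the same amount.\<close>

lemma far_schur:
  fixes m :: "real \<times> real \<Rightarrow> ennreal" and D :: real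
  assumes m [measurable]: "m \<in> borel_measurable borel" and D: "D > 1"
  shows "(\<integral>\<^sup>+ p. (\<integral>\<^sup>+ q. ennreal (\<bar>fst p - fst q\<bar> powr - D) * (m p * m q) *
      indicator {pq. 0 < snd (fst pq) \<and> 0 < snd (snd pq) \<and> far pq} (p, q) \<partial>lborel) \<partial>lborel)
    \<le> 2 * ennreal (far_const D) * (\<integral>\<^sup>+ p. (m p)\<^sup>2 * ennreal (snd p powr D) * indicator {p. 0 < snd p} p \<partial>lborel)"
proof -
  define T where "T = {pq. 0 < snd (fst pq) \<and> 0 < snd (snd pq) \<and> far pq}"
  have [measurable]: "T \<in> sets borel"
    unfolding T_def by measurable
  define k where "k pq = (m (fst pq))\<^sup>2 * (ennreal (\<bar>fst (fst pq) - fst (snd pq)\<bar> powr - D *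
      (snd (fst pq) / snd (snd pq)) powr ((D + 1) / 2)) * indicator T pq)" for pq
  have [measurable]: "k \<in> borel_measurable borel"
    unfolding k_def by measurable
  have "ennreal (\<bar>fst p - fst q\<bar> powr - D) * (m p * m q) * indicator T (p, q) \<le> k (p, q) + k (q, p)" for p q
  proof (cases "(p, q) \<in> T")
    case True
    then have sym: "(q, p) \<in> T" and pos: "snd p > 0" "snd q > 0"
      by (auto simp: T_def far_def sep_commute abs_minus_commute)
    (* The weight of the pair; exchanging p and q replaces it by its inverse. *)
    define w where "w = (snd p / snd q) powr ((D + 1) / 2)"
    have w: "w > 0" and inv: "(snd q / snd p) powr ((D + 1) / 2) = 1 / w"
      using pos by (auto simp: w_def powr_divide)
    define c where "c = \<bar>fst p - fst q\<bar> powr - D"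
    define w' where "w' = 1 / w"
    have w': "w' > 0" using w by (simp add: w'_def)
    have "ennreal c * (m p * m q) \<le> ennreal c * (ennreal w * (m p)\<^sup>2 + ennreal w' * (m q)\<^sup>2)"
      unfolding w'_def by (intro mult_left_mono ennreal_mult_le_weighted_squares w) simp
    also have "\<dots> = (m p)\<^sup>2 * ennreal (c * w) + (m q)\<^sup>2 * ennreal (c * w')"
      using w w' by (simp add: c_def ennreal_mult distrib_left mult_ac)
    finally show ?thesis
      using True sym by (simp add: k_def w_def[symmetric] c_def[symmetric] inv w'_def[symmetric] abs_minus_commute)
  qed simp
  then have "(\<integral>\<^sup>+ p. (\<integral>\<^sup>+ q. ennreal (\<bar>fst p - fst q\<bar> powr - D) * (m p * m q) * indicator T (p, q) \<partial>lborel) \<partial>lborel)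
      \<le> (\<integral>\<^sup>+ p. (\<integral>\<^sup>+ q. k (p, q) + k (q, p) \<partial>lborel) \<partial>lborel)"
    by (intro nn_integral_mono)
  also have "\<dots> = (\<integral>\<^sup>+ p. (\<integral>\<^sup>+ q. k (p, q) \<partial>lborel) \<partial>lborel) + (\<integral>\<^sup>+ p. (\<integral>\<^sup>+ q. k (q, p) \<partial>lborel) \<partial>lborel)"
    by (simp add: nn_integral_add)
  also have "\<dots> = 2 * (\<integral>\<^sup>+ p. (\<integral>\<^sup>+ q. k (p, q) \<partial>lborel) \<partial>lborel)"
    using nn_integral_lborel_swap[of k] by (simp add: mult_2)
  also have "(\<integral>\<^sup>+ p. (\<integral>\<^sup>+ q. k (p, q) \<partial>lborel) \<partial>lborel)
      \<le> (\<integral>\<^sup>+ p. ennreal (far_const D) * ((m p)\<^sup>2 * ennreal (snd p powr D) * indicator {p. 0 < snd p} p) \<partial>lborel)"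
  proof (rule nn_integral_mono)
    fix p :: "real \<times> real"
    show "(\<integral>\<^sup>+ q. k (p, q) \<partial>lborel) \<le> ennreal (far_const D) * ((m p)\<^sup>2 * ennreal (snd p powr D) * indicator {p. 0 < snd p} p)"
    proof (cases "snd p > 0")
      case True
      define h where "h q = ennreal (\<bar>fst p - fst q\<bar> powr - D * (snd p / snd q) powr ((D + 1) / 2)) *
        indicator {q. 0 < snd q \<and> far ((fst p, snd p), q)} q" for q :: "real \<times> real"
      have [measurable]: "h \<in> borel_measurable borel"
        unfolding h_def far_def by measurable
      have "(\<integral>\<^sup>+ q. k (p, q) \<partial>lborel) = (\<integral>\<^sup>+ q. (m p)\<^sup>2 * h q \<partial>lborel)"
        using True by (intro nn_integral_cong) (auto simp: k_def h_def T_def indicator_def)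
      also have "\<dots> = (m p)\<^sup>2 * (\<integral>\<^sup>+ q. h q \<partial>lborel)"
        by (rule nn_integral_cmult) simp
      also have "\<dots> \<le> (m p)\<^sup>2 * ennreal (far_const D * snd p powr D)"
        using nn_integral_far_kernel_le[OF D True, of "fst p"]
        by (intro mult_left_mono) (simp_all add: h_def)
      also have "\<dots> = ennreal (far_const D) * ((m p)\<^sup>2 * ennreal (snd p powr D))"
        using far_const_nonneg[of D] by (simp add: ennreal_mult mult_ac)
      finally show ?thesis using True by simp
    qed (simp add: k_def T_def)
  qed
  also have "\<dots> = ennreal (far_const D) * (\<integral>\<^sup>+ p. (m p)\<^sup>2 * ennreal (snd p powr D) * indicator {p. 0 < snd p} p \<partial>lborel)"
    by (rule nn_integral_cmult) measurable
  finally show ?thesis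
    by (simp add: T_def mult.assoc mult_left_mono)
qed

text \<open>With \<open>\<sigma> = (D + 1)/2\<close> write \<open>\<alpha> powr D\<close> as \<open>\<alpha> powr \<sigma> * \<alpha> powr (\<sigma> - 1)\<close>.  By Markov's inequality the first
  factor times the distribution function is at most the integral of \<open>h powr \<sigma>\<close>, and the second factor
  times the distribution function integrates to \<open>1/\<sigma>\<close> times the same integral.\<close>

lemma distribution_square_moment_le:
  fixes h :: "'a::euclidean_space \<Rightarrow> real" and D :: real
  assumes h [measurable]: "h \<in> borel_measurable borel" and nonneg: "\<And>y. h y \<ge> 0" and D: "D > 1"
  shows "(\<integral>\<^sup>+ \<alpha>. (emeasure lborel {y. \<alpha> < h y})\<^sup>2 * ennreal (\<alpha> powr D) * indicator {0<..} \<alpha> \<partial>lborel)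
    \<le> ennreal (2 / (D + 1)) * (\<integral>\<^sup>+ y. ennreal (h y powr ((D + 1) / 2)) \<partial>lborel)\<^sup>2"
proof -
  define \<sigma> where "\<sigma> = (D + 1) / 2"
  have \<sigma>: "\<sigma> > 1" using D by (simp add: \<sigma>_def)
  define P where "P = (\<integral>\<^sup>+ y. ennreal (h y powr \<sigma>) \<partial>lborel)"
  have markov: "ennreal (\<alpha> powr \<sigma>) * emeasure lborel {y. \<alpha> < h y} \<le> P" if "\<alpha> > 0" for \<alpha>
  proof -
    have "ennreal (\<alpha> powr \<sigma>) * emeasure lborel {y. \<alpha> < h y} = (\<integral>\<^sup>+ y. ennreal (\<alpha> powr \<sigma>) * indicator {y. \<alpha> < h y} y \<partial>lborel)"
      by (simp add: nn_integral_cmult)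
    also have "\<dots> \<le> P"
      unfolding P_def using that \<sigma>
      by (intro nn_integral_mono) (auto simp: indicator_def intro!: ennreal_leI powr_mono2)
    finally show ?thesis .
  qed
  have "(\<integral>\<^sup>+ \<alpha>. (emeasure lborel {y. \<alpha> < h y})\<^sup>2 * ennreal (\<alpha> powr D) * indicator {0<..} \<alpha> \<partial>lborel)
      \<le> (\<integral>\<^sup>+ \<alpha>. P * (\<integral>\<^sup>+ y. ennreal (\<alpha> powr (\<sigma> - 1)) * indicator {0..h y} \<alpha> \<partial>lborel) \<partial>lborel)"
  proof (rule nn_integral_mono)
    fix \<alpha> :: real
    show "(emeasure lborel {y. \<alpha> < h y})\<^sup>2 * ennreal (\<alpha> powr D) * indicator {0<..} \<alpha>
      \<le> P * (\<integral>\<^sup>+ y. ennreal (\<alpha> powr (\<sigma> - 1)) * indicator {0..h y} \<alpha> \<partial>lborel)"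
    proof (cases "\<alpha> > 0")
      case True
      have "\<sigma> + (\<sigma> - 1) = D"
        by (simp add: \<sigma>_def field_simps)
      then have "\<alpha> powr D = \<alpha> powr \<sigma> * \<alpha> powr (\<sigma> - 1)"
        by (simp only: powr_add[symmetric])
      then have "(emeasure lborel {y. \<alpha> < h y})\<^sup>2 * ennreal (\<alpha> powr D) * indicator {0<..} \<alpha>
        = (ennreal (\<alpha> powr \<sigma>) * emeasure lborel {y. \<alpha> < h y}) * (ennreal (\<alpha> powr (\<sigma> - 1)) * emeasure lborel {y. \<alpha> < h y})"
        using True by (simp add: ennreal_mult power2_eq_square mult_ac)
      also have "\<dots> \<le> P * (ennreal (\<alpha> powr (\<sigma> - 1)) * emeasure lborel {y. \<alpha> < h y})"
        by (intro mult_right_mono markov True) simp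
      also have "ennreal (\<alpha> powr (\<sigma> - 1)) * emeasure lborel {y. \<alpha> < h y} = (\<integral>\<^sup>+ y. ennreal (\<alpha> powr (\<sigma> - 1)) * indicator {y. \<alpha> < h y} y \<partial>lborel)"
        by (simp add: nn_integral_cmult)
      also have "\<dots> \<le> (\<integral>\<^sup>+ y. ennreal (\<alpha> powr (\<sigma> - 1)) * indicator {0..h y} \<alpha> \<partial>lborel)"
        using True by (intro nn_integral_mono) (auto simp: indicator_def)
      finally show ?thesis by (simp add: mult_left_mono)
    qed simp
  qed
  also have "\<dots> = P * (\<integral>\<^sup>+ \<alpha>. (\<integral>\<^sup>+ y. ennreal (\<alpha> powr (\<sigma> - 1)) * indicator {0..h y} \<alpha> \<partial>lborel) \<partial>lborel)"
    by (rule nn_integral_cmult) (simp add: indicator_def)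
  also have "(\<integral>\<^sup>+ \<alpha>. (\<integral>\<^sup>+ y. ennreal (\<alpha> powr (\<sigma> - 1)) * indicator {0..h y} \<alpha> \<partial>lborel) \<partial>lborel)
      = (\<integral>\<^sup>+ y. (\<integral>\<^sup>+ \<alpha>. ennreal (\<alpha> powr (\<sigma> - 1)) * indicator {0..h y} \<alpha> \<partial>lborel) \<partial>lborel)"
    using nn_integral_lborel_swap[of "\<lambda>p :: real \<times> 'a. ennreal (fst p powr (\<sigma> - 1)) * indicator {0..h (snd p)} (fst p)"]
    by (simp add: indicator_def)
  also have "\<dots> = (\<integral>\<^sup>+ y. ennreal (1 / \<sigma>) * ennreal (h y powr \<sigma>) \<partial>lborel)"
  proof (rule nn_integral_cong)
    fix y
    show "(\<integral>\<^sup>+ \<alpha>. ennreal (\<alpha> powr (\<sigma> - 1)) * indicator {0..h y} \<alpha> \<partial>lborel) = ennreal (1 / \<sigma>) * ennreal (h y powr \<sigma>)"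
      using nn_integral_powr_upto[of "\<sigma> - 1" "h y"] \<sigma> nonneg[of y] by (simp add: ennreal_mult[symmetric])
  qed
  also have "\<dots> = ennreal (1 / \<sigma>) * P"
    unfolding P_def by (rule nn_integral_cmult) measurable
  finally show ?thesis
    using D by (simp add: P_def \<sigma>_def power2_eq_square mult_ac)
qed

section \<open>The weak-type bound for the X-ray transform\<close>

definition xray :: "(real \<times> 'a::euclidean_space \<Rightarrow> real) \<Rightarrow> 'a \<times> 'a \<Rightarrow> ennreal" where
  "xray g z = (\<integral>\<^sup>+ t. ennreal (g (t, fst z + t *\<^sub>R snd z)) \<partial>lborel)"

text \<open>The \<open>n\<close>-th power of the norm of \<open>L\<^sup>n\<close> in time with values in \<open>L\<close> to the \<open>n/2\<close> in space, for
  \<open>n = DIM('a) + 1\<close>: the inner integral is the \<open>n/2\<close>-th power of the spatial norm, hence the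
  square.\<close>

definition dual_energy :: "(real \<times> 'a::euclidean_space \<Rightarrow> real) \<Rightarrow> ennreal" where
  "dual_energy g = (\<integral>\<^sup>+ t. (\<integral>\<^sup>+ y. ennreal (g (t, y) powr ((real DIM('a) + 1) / 2)) \<partial>lborel)\<^sup>2 \<partial>lborel)"

definition weak_const :: "real \<Rightarrow> real" where
  "weak_const D = 8 * far_const D / (D + 1)"

lemma xray_measurable [measurable]:
  fixes g :: "real \<times> 'a::euclidean_space \<Rightarrow> real"
  assumes [measurable]: "g \<in> borel_measurable borel"
  shows "xray g \<in> borel_measurable borel"
  unfolding xray_def by measurable

text \<open>Where \<open>xray g z > 1\<close>, the far pairs in the region under the graph have measure at least
  \<open>1/2\<close>.  Integrating this over all of phase space gives the bilinear form of \<open>far_schur\<close>, evaluated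
  at the distribution function \<open>m\<close>.\<close>

lemma xray_weak_type_1:
  fixes g :: "real \<times> 'a::euclidean_space \<Rightarrow> real"
  assumes g [measurable]: "g \<in> borel_measurable borel" and nonneg: "\<And>p. g p \<ge> 0" and dim: "DIM('a) \<ge> 2"
  shows "emeasure lborel {z. xray g z > 1} \<le> ennreal (weak_const (real DIM('a))) * dual_energy g"
proof -
  define D where "D = real DIM('a)"
  have D: "D > 1" using dim by (simp add: D_def)
  define U where "U z = {p. 0 < snd p \<and> snd p < g (fst p, fst z + fst p *\<^sub>R snd z)}" for z :: "'a \<times> 'a"
  have U [measurable]: "U z \<in> sets borel" for z
    unfolding U_def by measurable
  have pos_U: "snd p > 0" if "p \<in> U z" for p z
    using that by (simp add: U_def)
  define m where "m p = (\<integral>\<^sup>+ y. indicator {y. snd p < g (fst p, y)} y \<partial>lborel)" for p :: "real \<times> real"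
  have m [measurable]: "m \<in> borel_measurable borel"
    unfolding m_def indicator_def by measurable
  have meas_U: "emeasure lborel (U z) = xray g z" for z
  proof -
    have "emeasure lborel (U z) = (\<integral>\<^sup>+ p. indicator (U z) p \<partial>lborel)"
      by simp
    also have "\<dots> = (\<integral>\<^sup>+ t. (\<integral>\<^sup>+ \<alpha>. indicator (U z) (t, \<alpha>) \<partial>lborel) \<partial>lborel)"
      by (rule nn_integral_lborel_fst) simp
    also have "\<dots> = (\<integral>\<^sup>+ t. (\<integral>\<^sup>+ \<alpha>. indicator {0<..<g (t, fst z + t *\<^sub>R snd z)} \<alpha> \<partial>lborel) \<partial>lborel)"
      by (intro nn_integral_cong) (auto simp: U_def indicator_def)
    also have "\<dots> = xray g z"
      using nonneg by (simp add: xray_def)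
    finally show ?thesis .
  qed
  define H where "H z p q = (indicator {pq. fst pq \<in> U z \<and> snd pq \<in> U z \<and> far pq} (p, q) :: ennreal)" for z p q
  have H_alt: "H z p q = indicator {pq. 0 < snd (fst pq) \<and> 0 < snd (snd pq) \<and> far pq} (p, q) *
    (indicator {y. snd p < g (fst p, y)} (fst z + fst p *\<^sub>R snd z) * indicator {y. snd q < g (fst q, y)} (fst z + fst q *\<^sub>R snd z))" for z p q
    by (auto simp: H_def U_def indicator_def)
  have H [measurable]: "(\<lambda>x. H (f x) (f1 x) (f2 x)) \<in> borel_measurable N"
    if [measurable]: "f \<in> borel_measurable N" "f1 \<in> borel_measurable N" "f2 \<in> borel_measurable N"
    for f :: "'c \<Rightarrow> 'a \<times> 'a" and f1 f2 N
    unfolding H_def U_def indicator_def far_def by measurable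
  (* Far pairs have distinct times, so dispersion applies to them. *)
  have int_z: "(\<integral>\<^sup>+ z. H z p q \<partial>lborel) = ennreal (\<bar>fst p - fst q\<bar> powr - D) * (m p * m q) *
      indicator {pq. 0 < snd (fst pq) \<and> 0 < snd (snd pq) \<and> far pq} (p, q)" for p q
  proof (cases "0 < snd p \<and> 0 < snd q \<and> far (p, q)")
    case True
    then have "fst p \<noteq> fst q"
      using sep_pos[of "snd p" "snd q"] by (auto simp: far_def)
    then show ?thesis
      using True transport_dispersion[of "{y. snd p < g (fst p, y)}" "{y. snd q < g (fst q, y)}" "fst p" "fst q"]
      by (simp add: H_alt m_def D_def)
  qed (simp add: H_alt)
  have "indicator {z. xray g z > 1} z \<le> 2 * (\<integral>\<^sup>+ p. (\<integral>\<^sup>+ q. H z p q \<partial>lborel) \<partial>lborel)" for z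
    using far_pairs_ge[OF U[of z] pos_U] by (cases "xray g z > 1") (simp_all add: meas_U H_def)
  then have "(\<integral>\<^sup>+ z. indicator {z. xray g z > 1} z \<partial>lborel) \<le> (\<integral>\<^sup>+ z. 2 * (\<integral>\<^sup>+ p. (\<integral>\<^sup>+ q. H z p q \<partial>lborel) \<partial>lborel) \<partial>lborel)"
    by (rule nn_integral_mono)
  also have "\<dots> = 2 * (\<integral>\<^sup>+ z. (\<integral>\<^sup>+ p. (\<integral>\<^sup>+ q. H z p q \<partial>lborel) \<partial>lborel) \<partial>lborel)"
    by (rule nn_integral_cmult) measurable
  also have "(\<integral>\<^sup>+ z. (\<integral>\<^sup>+ p. (\<integral>\<^sup>+ q. H z p q \<partial>lborel) \<partial>lborel) \<partial>lborel)
      = (\<integral>\<^sup>+ p. (\<integral>\<^sup>+ z. (\<integral>\<^sup>+ q. H z p q \<partial>lborel) \<partial>lborel) \<partial>lborel)"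
    using nn_integral_lborel_swap[of "\<lambda>x. (\<integral>\<^sup>+ q. H (fst x) (snd x) q \<partial>lborel)"] by simp
  also have "\<dots> = (\<integral>\<^sup>+ p. (\<integral>\<^sup>+ q. (\<integral>\<^sup>+ z. H z p q \<partial>lborel) \<partial>lborel) \<partial>lborel)"
    using nn_integral_lborel_swap[of "\<lambda>x. H (fst x) _ (snd x)"] by simp
  also have "\<dots> \<le> 2 * ennreal (far_const D) * (\<integral>\<^sup>+ p. (m p)\<^sup>2 * ennreal (snd p powr D) * indicator {p. 0 < snd p} p \<partial>lborel)"
    unfolding int_z by (rule far_schur[OF m D])
  also have "(\<integral>\<^sup>+ p. (m p)\<^sup>2 * ennreal (snd p powr D) * indicator {p. 0 < snd p} p \<partial>lborel)
      = (\<integral>\<^sup>+ t. (\<integral>\<^sup>+ \<alpha>. (emeasure lborel {y. \<alpha> < g (t, y)})\<^sup>2 * ennreal (\<alpha> powr D) * indicator {0<..} \<alpha> \<partial>lborel) \<partial>lborel)"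
    by (subst nn_integral_lborel_fst) (auto simp: m_def indicator_def[of "{p. 0 < snd p}"] indicator_def[of "{0<..}"] intro!: nn_integral_cong)
  also have "\<dots> \<le> (\<integral>\<^sup>+ t. ennreal (2 / (D + 1)) * (\<integral>\<^sup>+ y. ennreal (g (t, y) powr ((D + 1) / 2)) \<partial>lborel)\<^sup>2 \<partial>lborel)"
    by (intro nn_integral_mono distribution_square_moment_le nonneg D) measurable
  also have "\<dots> = ennreal (2 / (D + 1)) * dual_energy g"
    unfolding dual_energy_def D_def by (rule nn_integral_cmult) measurable
  finally have "emeasure lborel {z. xray g z > 1} \<le> 2 * (2 * ennreal (far_const D) * (ennreal (2 / (D + 1)) * dual_energy g))"
    by (simp add: mult_left_mono)
  also have "\<dots> = ennreal (weak_const D) * dual_energy g"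
  proof -
    have "ennreal (weak_const D) = ennreal 4 * (ennreal (far_const D) * ennreal (2 / (D + 1)))"
      using D by (simp add: weak_const_def far_const_def ennreal_mult[symmetric] del: ennreal_numeral)
    moreover have "ennreal 4 = 2 * 2"
      by simp
    ultimately show ?thesis by (simp only: mult_ac)
  qed
  finally show ?thesis by (simp add: D_def)
qed

section \<open>Real powers of extended nonnegative reals\<close>

lemma enn_powr_ennreal: "x \<ge> 0 \<Longrightarrow> enn_powr (ennreal x) a = ennreal (x powr a)"
  by (simp add: enn_powr_def)

lemma enn_powr_top [simp]: "enn_powr top a = top"
  by (simp add: enn_powr_def)

lemma enn_powr_one [simp]: "enn_powr x 1 = x"
  by (cases x) (simp_all add: enn_powr_ennreal)

lemma enn_powr_powr: "enn_powr (enn_powr x a) b = enn_powr x (a * b)"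
  by (cases x) (simp_all add: enn_powr_ennreal powr_powr)

lemma enn_powr_mono: "a \<ge> 0 \<Longrightarrow> x \<le> y \<Longrightarrow> enn_powr x a \<le> enn_powr y a"
  by (cases x; cases y) (auto simp: enn_powr_ennreal top_unique intro!: ennreal_leI powr_mono2)

lemma enn_powr_measurable [measurable]:
  assumes [measurable]: "f \<in> borel_measurable M"
  shows "(\<lambda>x. enn_powr (f x) a) \<in> borel_measurable M"
  unfolding enn_powr_def by measurable

text \<open>The power is an order isomorphism with inverse the power \<open>1 / a\<close>, so it preserves suprema.\<close>

lemma enn_powr_SUP:
  fixes X :: "'i \<Rightarrow> ennreal"
  assumes a: "a > 0" and I: "I \<noteq> {}"
  shows "enn_powr (SUP i\<in>I. X i) a = (SUP i\<in>I. enn_powr (X i) a)"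
proof (rule antisym)
  show "(SUP i\<in>I. enn_powr (X i) a) \<le> enn_powr (SUP i\<in>I. X i) a"
    using a by (intro SUP_least enn_powr_mono SUP_upper) auto
  define Y where "Y = (SUP i\<in>I. enn_powr (X i) a)"
  have "X i \<le> enn_powr Y (1 / a)" if "i \<in> I" for i
  proof -
    have "X i = enn_powr (enn_powr (X i) a) (1 / a)"
      using a by (simp add: enn_powr_powr)
    also have "\<dots> \<le> enn_powr Y (1 / a)"
      unfolding Y_def using a that by (intro enn_powr_mono SUP_upper) auto
    finally show ?thesis .
  qed
  then have "enn_powr (SUP i\<in>I. X i) a \<le> enn_powr (enn_powr Y (1 / a)) a"
    using a by (intro enn_powr_mono SUP_least) auto
  also have "\<dots> = Y"
    using a by (simp add: enn_powr_powr)
  finally show "enn_powr (SUP i\<in>I. X i) a \<le> (SUP i\<in>I. enn_powr (X i) a)"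
    by (simp add: Y_def)
qed

section \<open>From the weak-type bound to the dual Lorentz estimate\<close>

lemma weak_const_nonneg: "D \<ge> 0 \<Longrightarrow> weak_const D \<ge> 0"
  by (simp add: weak_const_def far_const_nonneg)

text \<open>Homogeneity: replace \<open>g\<close> by \<open>g / l\<close>.\<close>

lemma xray_weak_type:
  fixes g :: "real \<times> 'a::euclidean_space \<Rightarrow> real"
  assumes g [measurable]: "g \<in> borel_measurable borel" and nonneg: "\<And>p. g p \<ge> 0" and dim: "DIM('a) \<ge> 2"
    and l: "l > 0"
  shows "emeasure lborel {z. xray g z > ennreal l}
    \<le> ennreal (weak_const (real DIM('a)) * l powr - (real DIM('a) + 1)) * dual_energy g"
proof -
  define D where "D = real DIM('a)"
  define h where "h p = g p / l" for p
  have h [measurable]: "h \<in> borel_measurable borel"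
    unfolding h_def by measurable
  have h_nonneg: "h p \<ge> 0" for p
    using nonneg l by (simp add: h_def)
  have X: "xray h z = ennreal (1 / l) * xray g z" for z
  proof -
    have "xray h z = (\<integral>\<^sup>+ t. ennreal (1 / l) * ennreal (g (t, fst z + t *\<^sub>R snd z)) \<partial>lborel)"
      unfolding xray_def h_def using l nonneg by (intro nn_integral_cong) (simp add: ennreal_mult[symmetric])
    also have "\<dots> = ennreal (1 / l) * xray g z"
      unfolding xray_def by (rule nn_integral_cmult) measurable
    finally show ?thesis .
  qed
  have "{z. xray g z > ennreal l} \<subseteq> {z. xray h z > 1}"
  proof
    fix z assume z: "z \<in> {z. xray g z > ennreal l}"
    have "\<not> xray h z \<le> 1"
    proof
      assume "xray h z \<le> 1"
      then have "ennreal l * xray h z \<le> ennreal l * 1"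
        by (rule mult_left_mono) simp
      moreover have "ennreal l * xray h z = xray g z"
        using l by (simp add: X mult.assoc[symmetric] ennreal_mult[symmetric])
      ultimately show False using z by auto
    qed
    then show "z \<in> {z. xray h z > 1}" by auto
  qed
  then have "emeasure lborel {z. xray g z > ennreal l} \<le> emeasure lborel {z. xray h z > 1}"
    by (intro emeasure_mono) simp_all
  also have "\<dots> \<le> ennreal (weak_const D) * dual_energy h"
    unfolding D_def by (intro xray_weak_type_1 h h_nonneg dim)
  also have "dual_energy h = ennreal (l powr - (D + 1)) * dual_energy g"
  proof -
    have "- ((D + 1) / 2) + - ((D + 1) / 2) = - (D + 1)"
      by (simp add: field_simps)
    then have sq: "(l powr - ((D + 1) / 2))\<^sup>2 = l powr - (D + 1)"
      by (simp only: power2_eq_square powr_add[symmetric])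
    have "(\<integral>\<^sup>+ y. ennreal (h (t, y) powr ((D + 1) / 2)) \<partial>lborel)
        = ennreal (l powr - ((D + 1) / 2)) * (\<integral>\<^sup>+ y. ennreal (g (t, y) powr ((D + 1) / 2)) \<partial>lborel)" for t
    proof -
      have "(\<integral>\<^sup>+ y. ennreal (h (t, y) powr ((D + 1) / 2)) \<partial>lborel)
         = (\<integral>\<^sup>+ y. ennreal (l powr - ((D + 1) / 2)) * ennreal (g (t, y) powr ((D + 1) / 2)) \<partial>lborel)"
        using l nonneg by (intro nn_integral_cong) (simp add: h_def powr_divide powr_minus_divide ennreal_mult[symmetric])
      also have "\<dots> = ennreal (l powr - ((D + 1) / 2)) * (\<integral>\<^sup>+ y. ennreal (g (t, y) powr ((D + 1) / 2)) \<partial>lborel)"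
        by (rule nn_integral_cmult) measurable
      finally show ?thesis .
    qed
    then have "dual_energy h = (\<integral>\<^sup>+ t. ennreal (l powr - (D + 1)) * (\<integral>\<^sup>+ y. ennreal (g (t, y) powr ((D + 1) / 2)) \<partial>lborel)\<^sup>2 \<partial>lborel)"
      unfolding dual_energy_def D_def[symmetric]
      by (intro nn_integral_cong) (simp add: power_mult_distrib ennreal_power sq del: minus_add_distrib)
    also have "\<dots> = ennreal (l powr - (D + 1)) * dual_energy g"
      unfolding dual_energy_def D_def by (rule nn_integral_cmult) measurable
    finally show ?thesis .
  qed
  finally show ?thesis
    by (simp add: D_def ennreal_mult' weak_const_nonneg mult.assoc)
qed

lemma ennreal_layer_cake:
  "x = (\<integral>\<^sup>+ l. indicator {l. 0 < l \<and> ennreal l < x} l \<partial>lborel)"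
proof (cases x)
  case (real r)
  then have "{l. 0 < l \<and> ennreal l < x} = {0<..<r}"
    by (auto simp: ennreal_less_iff)
  then show ?thesis using real by simp
next
  case top
  have "ennreal (real n) \<le> emeasure lborel {0 :: real<..}" for n
  proof -
    have "emeasure lborel {0<..<real n} \<le> emeasure lborel {0 :: real<..}"
      by (intro emeasure_mono) auto
    then show ?thesis by simp
  qed
  then have "(SUP n. of_nat n) \<le> emeasure lborel {0 :: real<..}"
    by (intro SUP_least) (simp add: ennreal_of_nat_eq_real_of_nat)
  then have "emeasure lborel {0 :: real<..} = top"
    by (simp add: ennreal_SUP_of_nat_eq_top top_unique)
  moreover have "{l. 0 < l \<and> ennreal l < x} = {0<..}"
    using top by auto
  ultimately show ?thesis using top by simp
qed

text \<open>Below the height \<open>l0\<close> the level sets of \<open>xray g\<close> inside \<open>E\<close> have at most the measure of \<open>E\<close>;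
  above it the weak-type bound is integrable.\<close>

lemma xray_restricted_threshold:
  fixes g :: "real \<times> 'a::euclidean_space \<Rightarrow> real"
  assumes g [measurable]: "g \<in> borel_measurable borel" and nonneg: "\<And>p. g p \<ge> 0" and dim: "DIM('a) \<ge> 2"
    and E [measurable]: "E \<in> sets borel" and l0: "l0 > 0"
  shows "(\<integral>\<^sup>+ z. indicator E z * xray g z \<partial>lborel)
    \<le> ennreal l0 * emeasure lborel E
      + ennreal (weak_const (real DIM('a)) / real DIM('a) * l0 powr - real DIM('a)) * dual_energy g"
proof -
  define D where "D = real DIM('a)"
  have D: "D > 1" using dim by (simp add: D_def)
  have W: "weak_const D \<ge> 0" using D by (simp add: weak_const_nonneg)
  have "(\<integral>\<^sup>+ z. indicator E z * xray g z \<partial>lborel)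
      = (\<integral>\<^sup>+ z. (\<integral>\<^sup>+ l. indicator E z * indicator {l. 0 < l \<and> ennreal l < xray g z} l \<partial>lborel) \<partial>lborel)"
    by (subst (1) ennreal_layer_cake[of "xray g _"]) (simp add: nn_integral_cmult)
  also have "\<dots> = (\<integral>\<^sup>+ l. (\<integral>\<^sup>+ z. indicator E z * indicator {l. 0 < l \<and> ennreal l < xray g z} l \<partial>lborel) \<partial>lborel)"
    using nn_integral_lborel_swap[of "\<lambda>p. indicator E (fst p) * indicator {l. 0 < l \<and> ennreal l < xray g (fst p)} (snd p) :: ennreal"]
    by (simp add: indicator_def[of "{l. _ l}"])
  also have "\<dots> \<le> (\<integral>\<^sup>+ l. emeasure lborel E * indicator {0..l0} l
       + ennreal (weak_const D) * dual_energy g * (ennreal (l powr - (D + 1)) * indicator {l0..} l) \<partial>lborel)"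
  proof (rule nn_integral_mono)
    fix l :: real
    show "(\<integral>\<^sup>+ z. indicator E z * indicator {l. 0 < l \<and> ennreal l < xray g z} l \<partial>lborel) \<le> emeasure lborel E * indicator {0..l0} l
       + ennreal (weak_const D) * dual_energy g * (ennreal (l powr - (D + 1)) * indicator {l0..} l)"
    proof (cases "0 < l")
      case True
      show ?thesis
      proof (cases "l \<le> l0")
        case le: True
        have "(\<integral>\<^sup>+ z. indicator E z * indicator {l. 0 < l \<and> ennreal l < xray g z} l \<partial>lborel) \<le> (\<integral>\<^sup>+ z. indicator E z \<partial>lborel)"
          by (intro nn_integral_mono) (auto simp: indicator_def)
        also have "\<dots> = emeasure lborel E"
          by simp
        finally show ?thesis
          using True le by (simp add: add_increasing2)
      next
        case gt: False
        have "(\<integral>\<^sup>+ z. indicator E z * indicator {l. 0 < l \<and> ennreal l < xray g z} l \<partial>lborel) \<le> (\<integral>\<^sup>+ z. indicator {z. xray g z > ennreal l} z \<partial>lborel)"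
          by (intro nn_integral_mono) (auto simp: indicator_def)
        also have "\<dots> = emeasure lborel {z. xray g z > ennreal l}"
          by simp
        also have "\<dots> \<le> ennreal (weak_const D * l powr - (D + 1)) * dual_energy g"
          unfolding D_def by (intro xray_weak_type g nonneg dim True)
        finally show ?thesis
          using gt W by (simp add: ennreal_mult mult_ac)
      qed
    qed simp
  qed
  also have "\<dots> = ennreal l0 * emeasure lborel E + ennreal (weak_const D) * dual_energy g * ennreal (l0 powr - D / D)"
    using nn_integral_powr_from[of "- (D + 1)" l0] D l0
    by (simp add: nn_integral_add nn_integral_cmult mult.commute)
  also have "\<dots> = ennreal l0 * emeasure lborel E + ennreal (weak_const D / D * l0 powr - D) * dual_energy g"
    using W D by (simp add: ennreal_mult'[symmetric] mult_ac)
  finally show ?thesis by (simp add: D_def)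
qed

text \<open>The threshold \<open>(A / e) powr (1 / (D + 1))\<close> balances the two terms for a set of measure \<open>e\<close>.\<close>

lemma xray_restricted:
  fixes g :: "real \<times> 'a::euclidean_space \<Rightarrow> real"
  assumes g [measurable]: "g \<in> borel_measurable borel" and nonneg: "\<And>p. g p \<ge> 0" and dim: "DIM('a) \<ge> 2"
    and E [measurable]: "E \<in> sets borel" and A: "dual_energy g = ennreal A" "A > 0"
  shows "(\<integral>\<^sup>+ z. indicator E z * xray g z \<partial>lborel)
    \<le> ennreal ((1 + weak_const (real DIM('a)) / real DIM('a)) * A powr (1 / (real DIM('a) + 1)))
      * enn_powr (emeasure lborel E) (real DIM('a) / (real DIM('a) + 1))"
proof -
  define D where "D = real DIM('a)"
  have D: "D > 1" using dim by (simp add: D_def)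
  have expo: "1 / (D + 1) + D / (D + 1) = 1"
  proof -
    have "D + 1 \<noteq> 0"
      using D by linarith
    then show ?thesis
      by (simp add: add_divide_distrib[symmetric] add.commute)
  qed
  define W where "W = weak_const D / D"
  have W: "W \<ge> 0" using D by (simp add: W_def weak_const_nonneg)
  have pos: "(1 + W) * A powr (1 / (D + 1)) > 0"
    using A W by (simp add: add_pos_nonneg)
  consider "emeasure lborel E = top" | "emeasure lborel E = 0" | e where "emeasure lborel E = ennreal e" "e > 0"
    by (cases "emeasure lborel E") (auto simp: less_le)
  then have "(\<integral>\<^sup>+ z. indicator E z * xray g z \<partial>lborel)
    \<le> ennreal ((1 + W) * A powr (1 / (D + 1))) * enn_powr (emeasure lborel E) (D / (D + 1))"
  proof cases
    case 1
    then show ?thesis using A W by (auto simp: ennreal_mult_top)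
  next
    case 2
    then have "AE z in lborel. indicator E z * xray g z = 0"
      by (intro AE_I[of _ _ E]) (auto simp: indicator_def)
    then have "(\<integral>\<^sup>+ z. indicator E z * xray g z \<partial>lborel) = 0"
      by (subst nn_integral_0_iff_AE) auto
    then show ?thesis by simp
  next
    case (3 e)
    define l0 where "l0 = (A / e) powr (1 / (D + 1))"
    have l0: "l0 > 0" using A 3 by (simp add: l0_def)
    have t1: "l0 * e = A powr (1 / (D + 1)) * e powr (D / (D + 1))"
    proof -
      have "e = e powr (1 / (D + 1)) * e powr (D / (D + 1))"
        using 3 D by (simp add: powr_add[symmetric] expo)
      then show ?thesis
        using A 3 by (simp add: l0_def powr_divide field_simps)
    qed
    have t2: "l0 powr - D * A = A powr (1 / (D + 1)) * e powr (D / (D + 1))"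
    proof -
      have A_split: "A = A powr (1 / (D + 1)) * A powr (D / (D + 1))"
        using A by (simp add: powr_add[symmetric] expo)
      have "l0 powr - D = e powr (D / (D + 1)) / A powr (D / (D + 1))"
        using A 3 by (simp add: l0_def powr_powr powr_divide powr_minus_divide)
      from arg_cong2[where f = "(*)", OF this A_split]
      show ?thesis
        using A by (simp add: mult_ac)
    qed
    have "(\<integral>\<^sup>+ z. indicator E z * xray g z \<partial>lborel) \<le> ennreal l0 * ennreal e + ennreal (W * l0 powr - D) * ennreal A"
      using xray_restricted_threshold[OF g nonneg dim E l0] by (simp add: A 3 W_def D_def)
    also have "\<dots> = ennreal (l0 * e + W * (l0 powr - D * A))"
      using l0 3 A W by (simp add: ennreal_mult[symmetric] ennreal_plus[symmetric] mult_ac del: ennreal_plus)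
    also have "l0 * e + W * (l0 powr - D * A) = (1 + W) * A powr (1 / (D + 1)) * e powr (D / (D + 1))"
      unfolding t1 t2 by (simp add: algebra_simps)
    also have "ennreal \<dots> = ennreal ((1 + W) * A powr (1 / (D + 1))) * enn_powr (emeasure lborel E) (D / (D + 1))"
      using 3 pos by (simp add: enn_powr_ennreal ennreal_mult[symmetric])
    finally show ?thesis .
  qed
  then show ?thesis by (simp add: D_def W_def)
qed

text \<open>The Lorentz norm of \<open>F\<close> with exponents \<open>(DIM('a) + 1) / DIM('a)\<close> and \<open>1\<close>, up to the normalising
  constant.\<close>

definition lorentz_integral :: "('a::euclidean_space \<times> 'a \<Rightarrow> real) \<Rightarrow> ennreal" where
  "lorentz_integral F = (\<integral>\<^sup>+ s. enn_powr (emeasure lborel {z. s < F z}) (real DIM('a) / (real DIM('a) + 1)) * indicator {0<..} s \<partial>lborel)"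

text \<open>Write \<open>F\<close> as the integral of the indicators of its level sets and apply the bound for sets to each
  level.\<close>

lemma xray_lorentz_dual:
  fixes g :: "real \<times> 'a::euclidean_space \<Rightarrow> real" and F :: "'a \<times> 'a \<Rightarrow> real"
  assumes g [measurable]: "g \<in> borel_measurable borel" and nonneg: "\<And>p. g p \<ge> 0" and dim: "DIM('a) \<ge> 2"
    and F [measurable]: "F \<in> borel_measurable borel" and F_nonneg: "\<And>z. F z \<ge> 0"
    and A: "dual_energy g = ennreal A" "A > 0"
  shows "(\<integral>\<^sup>+ z. ennreal (F z) * xray g z \<partial>lborel)
    \<le> ennreal ((1 + weak_const (real DIM('a)) / real DIM('a)) * A powr (1 / (real DIM('a) + 1))) * lorentz_integral F"
proof -
  define K where "K = (1 + weak_const (real DIM('a)) / real DIM('a)) * A powr (1 / (real DIM('a) + 1))"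
  define \<theta> where "\<theta> = real DIM('a) / (real DIM('a) + 1)"
  have "(\<integral>\<^sup>+ z. ennreal (F z) * xray g z \<partial>lborel)
      = (\<integral>\<^sup>+ z. (\<integral>\<^sup>+ s. indicator {s. 0 < s \<and> s < F z} s * xray g z \<partial>lborel) \<partial>lborel)"
  proof (rule nn_integral_cong)
    fix z :: "'a \<times> 'a"
    have "ennreal (F z) = (\<integral>\<^sup>+ s. indicator {s. 0 < s \<and> s < F z} s \<partial>lborel)"
      using ennreal_layer_cake[of "ennreal (F z)"] F_nonneg[of z]
      by (simp add: ennreal_less_iff less_imp_le cong: conj_cong)
    then show "ennreal (F z) * xray g z = (\<integral>\<^sup>+ s. indicator {s. 0 < s \<and> s < F z} s * xray g z \<partial>lborel)"
      by (simp add: nn_integral_multc)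
  qed
  also have "\<dots> = (\<integral>\<^sup>+ s. (\<integral>\<^sup>+ z. indicator {s. 0 < s \<and> s < F z} s * xray g z \<partial>lborel) \<partial>lborel)"
    using nn_integral_lborel_swap[of "\<lambda>p. indicator {s. 0 < s \<and> s < F (fst p)} (snd p) * xray g (fst p) :: ennreal"]
    by (simp add: indicator_def)
  also have "\<dots> \<le> (\<integral>\<^sup>+ s. ennreal K * (enn_powr (emeasure lborel {z. s < F z}) \<theta> * indicator {0<..} s) \<partial>lborel)"
  proof (rule nn_integral_mono)
    fix s :: real
    show "(\<integral>\<^sup>+ z. indicator {s. 0 < s \<and> s < F z} s * xray g z \<partial>lborel)
      \<le> ennreal K * (enn_powr (emeasure lborel {z. s < F z}) \<theta> * indicator {0<..} s)"
    proof (cases "s > 0")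
      case True
      then have "(\<integral>\<^sup>+ z. indicator {s. 0 < s \<and> s < F z} s * xray g z \<partial>lborel) = (\<integral>\<^sup>+ z. indicator {z. s < F z} z * xray g z \<partial>lborel)"
        by (intro nn_integral_cong) (auto simp: indicator_def)
      also have "\<dots> \<le> ennreal K * enn_powr (emeasure lborel {z. s < F z}) \<theta>"
        unfolding K_def \<theta>_def by (intro xray_restricted g nonneg dim A) measurable
      finally show ?thesis using True by simp
    qed simp
  qed
  also have "\<dots> = ennreal K * (\<integral>\<^sup>+ s. enn_powr (\<integral>\<^sup>+ z. indicator {z. s < F z} z \<partial>lborel) \<theta> * indicator {0<..} s \<partial>lborel)"
    by (subst nn_integral_cmult[symmetric]) (simp_all add: indicator_def[of "{z. _ z}"])
  also have "\<dots> = ennreal K * lorentz_integral F"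
    by (simp add: lorentz_integral_def \<theta>_def)
  finally show ?thesis by (simp add: K_def)
qed

section \<open>The velocity average as the adjoint of the X-ray transform\<close>

lemma transport_duality:
  fixes g :: "real \<times> 'a::euclidean_space \<Rightarrow> real" and F :: "'a \<times> 'a \<Rightarrow> real"
  assumes g [measurable]: "g \<in> borel_measurable borel" and F [measurable]: "F \<in> borel_measurable borel"
  shows "(\<integral>\<^sup>+ z. ennreal (F z) * xray g z \<partial>lborel)
    = (\<integral>\<^sup>+ t. (\<integral>\<^sup>+ x. (\<integral>\<^sup>+ v. ennreal (F (x - t *\<^sub>R v, v)) \<partial>lborel) * ennreal (g (t, x)) \<partial>lborel) \<partial>lborel)"
proof -
  have "(\<integral>\<^sup>+ z. ennreal (F z) * xray g z \<partial>lborel)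
      = (\<integral>\<^sup>+ z. (\<integral>\<^sup>+ t. ennreal (F z) * ennreal (g (t, fst z + t *\<^sub>R snd z)) \<partial>lborel) \<partial>lborel)"
    unfolding xray_def by (subst nn_integral_cmult) simp_all
  also have "\<dots> = (\<integral>\<^sup>+ t. (\<integral>\<^sup>+ z. ennreal (F z) * ennreal (g (t, fst z + t *\<^sub>R snd z)) \<partial>lborel) \<partial>lborel)"
    using nn_integral_lborel_swap[of "\<lambda>p. ennreal (F (fst p)) * ennreal (g (snd p, fst (fst p) + snd p *\<^sub>R snd (fst p)))"]
    by simp
  also have "\<dots> = (\<integral>\<^sup>+ t. (\<integral>\<^sup>+ x. (\<integral>\<^sup>+ v. ennreal (F (x - t *\<^sub>R v, v)) \<partial>lborel) * ennreal (g (t, x)) \<partial>lborel) \<partial>lborel)"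
  proof (rule nn_integral_cong)
    fix t :: real
    have "(\<integral>\<^sup>+ z. ennreal (F z) * ennreal (g (t, fst z + t *\<^sub>R snd z)) \<partial>lborel)
        = (\<integral>\<^sup>+ v. (\<integral>\<^sup>+ x. ennreal (F (x, v)) * ennreal (g (t, x + t *\<^sub>R v)) \<partial>lborel) \<partial>lborel)"
      by (subst nn_integral_lborel_snd) simp_all
    also have "\<dots> = (\<integral>\<^sup>+ v. (\<integral>\<^sup>+ x. ennreal (F (x - t *\<^sub>R v, v)) * ennreal (g (t, x)) \<partial>lborel) \<partial>lborel)"
    proof (rule nn_integral_cong)
      fix v :: 'a
      show "(\<integral>\<^sup>+ x. ennreal (F (x, v)) * ennreal (g (t, x + t *\<^sub>R v)) \<partial>lborel)
        = (\<integral>\<^sup>+ x. ennreal (F (x - t *\<^sub>R v, v)) * ennreal (g (t, x)) \<partial>lborel)"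
        using nn_integral_lborel_translate[of "\<lambda>x. ennreal (F (x - t *\<^sub>R v, v)) * ennreal (g (t, x))" "t *\<^sub>R v"]
        by simp
    qed
    also have "\<dots> = (\<integral>\<^sup>+ x. (\<integral>\<^sup>+ v. ennreal (F (x - t *\<^sub>R v, v)) * ennreal (g (t, x)) \<partial>lborel) \<partial>lborel)"
      using nn_integral_lborel_swap[of "\<lambda>p. ennreal (F (fst p - t *\<^sub>R snd p, snd p)) * ennreal (g (t, fst p))"]
      by simp
    also have "\<dots> = (\<integral>\<^sup>+ x. (\<integral>\<^sup>+ v. ennreal (F (x - t *\<^sub>R v, v)) \<partial>lborel) * ennreal (g (t, x)) \<partial>lborel)"
      by (simp add: nn_integral_multc)
    finally show "(\<integral>\<^sup>+ z. ennreal (F z) * ennreal (g (t, fst z + t *\<^sub>R snd z)) \<partial>lborel)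
       = (\<integral>\<^sup>+ x. (\<integral>\<^sup>+ v. ennreal (F (x - t *\<^sub>R v, v)) \<partial>lborel) * ennreal (g (t, x)) \<partial>lborel)" .
  qed
  finally show ?thesis .
qed

section \<open>Duality for the mixed norm\<close>

text \<open>Cutting off both height and support makes all mixed norms finite, as is needed to divide
  by a power of the norm in the duality argument.\<close>

definition truncation :: "(real \<times> 'a::euclidean_space \<Rightarrow> ennreal) \<Rightarrow> nat \<Rightarrow> real \<times> 'a \<Rightarrow> ennreal" where
  "truncation \<rho> k p = min (\<rho> p) (of_nat k) * indicator (cball 0 (real k)) p"

lemma truncation_measurable [measurable]:
  fixes \<rho> :: "real \<times> 'a::euclidean_space \<Rightarrow> ennreal"
  assumes [measurable]: "\<rho> \<in> borel_measurable borel"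
  shows "truncation \<rho> k \<in> borel_measurable borel"
proof -
  have [measurable]: "cball 0 (real k) \<in> sets (borel :: (real \<times> 'a) measure)"
    by simp
  show ?thesis
    unfolding truncation_def by measurable
qed

lemma truncation_le: "truncation \<rho> k p \<le> \<rho> p" "truncation \<rho> k p \<le> of_nat k"
  by (auto simp: truncation_def indicator_def)

lemma truncation_mono: "k \<le> l \<Longrightarrow> truncation \<rho> k p \<le> truncation \<rho> l p"
  by (auto simp: truncation_def indicator_def intro: min.coboundedI2 order_trans[OF min.cobounded2])

lemma SUP_truncation: "(SUP k. truncation \<rho> k p) = \<rho> p"
proof (rule antisym)
  show "(SUP k. truncation \<rho> k p) \<le> \<rho> p"
    by (intro SUP_least truncation_le)
  show "\<rho> p \<le> (SUP k. truncation \<rho> k p)"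
  proof (rule dense_le)
    fix y assume y: "y < \<rho> p"
    then have "y < top" by (rule order.strict_trans2) simp
    then have "y < (SUP n. of_nat n)"
      by (simp add: ennreal_SUP_of_nat_eq_top)
    then obtain m :: nat where m: "y < of_nat m"
      by (auto simp: less_SUP_iff)
    obtain l where l: "norm p \<le> real l"
      using real_arch_simple by blast
    define k where "k = max m l"
    have "(of_nat m :: ennreal) \<le> of_nat k" and "norm p \<le> real k"
      using l by (auto simp: k_def)
    with m have "y \<le> of_nat k"
      by (meson less_imp_le order_trans)
    with \<open>norm p \<le> real k\<close> y have "y \<le> truncation \<rho> k p"
      by (simp add: truncation_def less_imp_le)
    also have "\<dots> \<le> (SUP k. truncation \<rho> k p)"
      by (rule SUP_upper) simp
    finally show "y \<le> (SUP k. truncation \<rho> k p)" .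
  qed
qed

text \<open>The \<open>q\<close>-th power of the mixed norm with exponents \<open>q = (DIM('a) + 1) / DIM('a)\<close> in time and
  \<open>b = (DIM('a) + 1) / (DIM('a) - 1)\<close> in space; the inner power is \<open>q / b\<close>.\<close>

definition mixed_power :: "(real \<times> 'a::euclidean_space \<Rightarrow> ennreal) \<Rightarrow> ennreal" where
  "mixed_power \<rho> = (\<integral>\<^sup>+ t. enn_powr (\<integral>\<^sup>+ x. enn_powr (\<rho> (t, x)) ((real DIM('a) + 1) / (real DIM('a) - 1)) \<partial>lborel)
      ((real DIM('a) - 1) / real DIM('a)) \<partial>lborel)"

lemma SUP_mixed_power_truncation:
  fixes \<rho> :: "real \<times> 'a::euclidean_space \<Rightarrow> ennreal"
  assumes \<rho> [measurable]: "\<rho> \<in> borel_measurable borel" and dim: "DIM('a) \<ge> 2"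
  shows "(SUP k. mixed_power (truncation \<rho> k)) = mixed_power \<rho>"
proof -
  define b where "b = (real DIM('a) + 1) / (real DIM('a) - 1)"
  define c where "c = (real DIM('a) - 1) / real DIM('a)"
  have b: "b > 0" and c: "c > 0" using dim by (auto simp: b_def c_def)
  define B where "B k t = (\<integral>\<^sup>+ x. enn_powr (truncation \<rho> k (t, x)) b \<partial>lborel)" for k t
  have B_meas [measurable]: "B k \<in> borel_measurable borel" for k
    unfolding B_def by measurable
  have B_mono: "B k t \<le> B l t" if "k \<le> l" for k l t
    unfolding B_def using b that by (intro nn_integral_mono enn_powr_mono truncation_mono) auto
  have B_SUP: "(SUP k. B k t) = (\<integral>\<^sup>+ x. enn_powr (\<rho> (t, x)) b \<partial>lborel)" for t
  proof -
    have "(SUP k. B k t) = (\<integral>\<^sup>+ x. (SUP k. enn_powr (truncation \<rho> k (t, x)) b) \<partial>lborel)"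
      unfolding B_def using b
      by (intro nn_integral_monotone_convergence_SUP[symmetric])
        (auto simp: incseq_def le_fun_def intro!: enn_powr_mono truncation_mono)
    also have "\<dots> = (\<integral>\<^sup>+ x. enn_powr (\<rho> (t, x)) b \<partial>lborel)"
      using b by (simp add: enn_powr_SUP[symmetric] SUP_truncation)
    finally show ?thesis .
  qed
  have "(SUP k. mixed_power (truncation \<rho> k)) = (SUP k. \<integral>\<^sup>+ t. enn_powr (B k t) c \<partial>lborel)"
    by (simp add: mixed_power_def B_def b_def c_def)
  also have "\<dots> = (\<integral>\<^sup>+ t. (SUP k. enn_powr (B k t) c) \<partial>lborel)"
    using c by (intro nn_integral_monotone_convergence_SUP[symmetric])
      (auto simp: incseq_def le_fun_def intro!: enn_powr_mono B_mono)
  also have "\<dots> = mixed_power \<rho>"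
    using c by (simp add: enn_powr_SUP[symmetric] B_SUP mixed_power_def b_def c_def)
  finally show ?thesis .
qed

text \<open>The function \<open>g\<close> is the extremal one in Hoelder's inequality for the mixed norm: \<open>\<eta>\<close> to the power
  \<open>b - 1 = 2 / (D - 1)\<close>, normalised at each time by a power of \<open>B\<close>.  Both its dual energy and its pairing with
  \<open>\<eta>\<close> equal the mixed power of \<open>\<eta>\<close>.  At times with \<open>B t = 0\<close> the convention that
  \<open>0 powr e = 0\<close> makes \<open>g\<close> vanish, consistently with \<open>\<eta>\<close>.\<close>

lemma dual_test_function:
  fixes \<eta> :: "real \<times> 'a::euclidean_space \<Rightarrow> real" and B :: "real \<Rightarrow> real"
  assumes \<eta> [measurable]: "\<eta> \<in> borel_measurable borel" and \<eta>_nonneg: "\<And>p. \<eta> p \<ge> 0"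
    and B [measurable]: "B \<in> borel_measurable borel" and B_nonneg: "\<And>t. B t \<ge> 0"
    and B_eq: "\<And>t. (\<integral>\<^sup>+ x. ennreal (\<eta> (t, x) powr ((real DIM('a) + 1) / (real DIM('a) - 1))) \<partial>lborel) = ennreal (B t)"
    and dim: "DIM('a) \<ge> 2"
  defines "g \<equiv> \<lambda>p. \<eta> p powr (2 / (real DIM('a) - 1)) * B (fst p) powr (- 1 / real DIM('a))"
  shows "dual_energy g = (\<integral>\<^sup>+ t. ennreal (B t powr ((real DIM('a) - 1) / real DIM('a))) \<partial>lborel)"
    and "(\<integral>\<^sup>+ t. (\<integral>\<^sup>+ x. ennreal (\<eta> (t, x)) * ennreal (g (t, x)) \<partial>lborel) \<partial>lborel)
      = (\<integral>\<^sup>+ t. ennreal (B t powr ((real DIM('a) - 1) / real DIM('a))) \<partial>lborel)"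
proof -
  define D where "D = real DIM('a)"
  have D: "D > 1" using dim by (simp add: D_def)
  define b where "b = (D + 1) / (D - 1)"
  have e1: "2 / (D - 1) * ((D + 1) / 2) = b"
    using D by (simp add: b_def frac_eq_eq algebra_simps)
  have e2: "2 / (D - 1) + 1 = b"
    using D by (simp add: b_def field_simps)
  have e3: "1 + - 1 / D * ((D + 1) / 2) + (1 + - 1 / D * ((D + 1) / 2)) = (D - 1) / D"
    using D by (simp add: field_simps)
  have e4: "1 + - 1 / D = (D - 1) / D"
    using D by (simp add: field_simps)
  have split: "B t * B t powr e = B t powr (1 + e)" for t e
    using B_nonneg[of t] by (simp add: powr_add)
  have "(\<integral>\<^sup>+ y. ennreal (g (t, y) powr ((D + 1) / 2)) \<partial>lborel)\<^sup>2 = ennreal (B t powr ((D - 1) / D))" for t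
  proof -
    have "(\<integral>\<^sup>+ y. ennreal (g (t, y) powr ((D + 1) / 2)) \<partial>lborel)
        = (\<integral>\<^sup>+ y. ennreal (\<eta> (t, y) powr b) * ennreal (B t powr (- 1 / D * ((D + 1) / 2))) \<partial>lborel)"
      using e1 by (intro nn_integral_cong) (simp only: g_def fst_conv powr_mult powr_powr powr_ge_zero D_def[symmetric] ennreal_mult[symmetric])
    also have "\<dots> = ennreal (B t) * ennreal (B t powr (- 1 / D * ((D + 1) / 2)))"
      using B_eq[of t] by (simp add: nn_integral_multc b_def D_def)
    also have "\<dots> = ennreal (B t powr (1 + - 1 / D * ((D + 1) / 2)))"
      using B_nonneg[of t] by (simp only: ennreal_mult[symmetric] powr_ge_zero split)
    finally show ?thesis
      by (simp only: ennreal_power powr_ge_zero power2_eq_square ennreal_mult[symmetric] powr_add[symmetric] e3)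
  qed
  then show "dual_energy g = (\<integral>\<^sup>+ t. ennreal (B t powr ((real DIM('a) - 1) / real DIM('a))) \<partial>lborel)"
    by (simp add: dual_energy_def D_def)
  have "(\<integral>\<^sup>+ x. ennreal (\<eta> (t, x)) * ennreal (g (t, x)) \<partial>lborel) = ennreal (B t powr ((D - 1) / D))" for t
  proof -
    have "\<eta> p * \<eta> p powr (2 / (D - 1)) = \<eta> p powr b" for p
      using \<eta>_nonneg[of p] by (simp add: e2[symmetric] powr_add mult.commute)
    then have "(\<integral>\<^sup>+ x. ennreal (\<eta> (t, x)) * ennreal (g (t, x)) \<partial>lborel)
        = (\<integral>\<^sup>+ x. ennreal (\<eta> (t, x) powr b) * ennreal (B t powr (- 1 / D)) \<partial>lborel)"
      using \<eta>_nonneg by (intro nn_integral_cong) (simp add: g_def ennreal_mult[symmetric] D_def[symmetric] mult.assoc[symmetric])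
    also have "\<dots> = ennreal (B t) * ennreal (B t powr (- 1 / D))"
      using B_eq[of t] by (simp add: nn_integral_multc b_def D_def)
    also have "\<dots> = ennreal (B t powr ((D - 1) / D))"
      using B_nonneg[of t] by (simp only: ennreal_mult[symmetric] powr_ge_zero split e4)
    finally show ?thesis .
  qed
  then show "(\<integral>\<^sup>+ t. (\<integral>\<^sup>+ x. ennreal (\<eta> (t, x)) * ennreal (g (t, x)) \<partial>lborel) \<partial>lborel)
      = (\<integral>\<^sup>+ t. ennreal (B t powr ((real DIM('a) - 1) / real DIM('a))) \<partial>lborel)"
    by (simp add: D_def)
qed

text \<open>Let \<open>A\<close> be the mixed power of a truncation of \<open>\<rho>\<close>.  Testing against the extremal function gives
  \<open>A \<le> c * A powr (1 / (D + 1))\<close>; since \<open>A\<close> is finite, this can be solved for \<open>A\<close>, and the bound survives the removal of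
  the truncation by monotone convergence.\<close>

lemma mixed_power_le_by_duality:
  fixes \<rho> :: "real \<times> 'a::euclidean_space \<Rightarrow> ennreal" and c :: ennreal
  assumes \<rho> [measurable]: "\<rho> \<in> borel_measurable borel" and dim: "DIM('a) \<ge> 2"
    and dual: "\<And>g A. g \<in> borel_measurable borel \<Longrightarrow> (\<And>p. g p \<ge> 0) \<Longrightarrow> dual_energy g = ennreal A \<Longrightarrow> A > 0 \<Longrightarrow>
      (\<integral>\<^sup>+ t. (\<integral>\<^sup>+ x. \<rho> (t, x) * ennreal (g (t, x)) \<partial>lborel) \<partial>lborel)
        \<le> c * ennreal (A powr (1 / (real DIM('a) + 1)))"
  shows "mixed_power \<rho> \<le> enn_powr c ((real DIM('a) + 1) / real DIM('a))"
proof -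
  define D where "D = real DIM('a)"
  have D: "D > 1" using dim by (simp add: D_def)
  define b where "b = (D + 1) / (D - 1)"
  have b: "b > 0" using D by (simp add: b_def)
  have "mixed_power (truncation \<rho> k) \<le> enn_powr c ((D + 1) / D)" for k
  proof -
    define \<eta> where "\<eta> p = enn2real (truncation \<rho> k p)" for p
    have \<eta> [measurable]: "\<eta> \<in> borel_measurable borel"
      unfolding \<eta>_def by measurable
    have \<eta>_nonneg: "\<eta> p \<ge> 0" for p by (simp add: \<eta>_def)
    have trunc: "truncation \<rho> k p = ennreal (\<eta> p)" for p
      using order.strict_trans1[OF truncation_le(2)[of \<rho> k p] of_nat_less_top] by (simp add: \<eta>_def)
    have \<eta>_le: "\<eta> p \<le> real k" for p
      using truncation_le(2)[of \<rho> k p] by (simp add: trunc ennreal_of_nat_eq_real_of_nat)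
    have \<eta>_0: "\<eta> p = 0" if "norm p > real k" for p
      using that by (simp add: \<eta>_def truncation_def)
    define B where "B t = enn2real (\<integral>\<^sup>+ x. ennreal (\<eta> (t, x) powr b) \<partial>lborel)" for t
    define V where "V = real k powr b * measure lborel (cball 0 (real k) :: 'a set)"
    have V: "V \<ge> 0" by (simp add: V_def)
    have bound: "(\<integral>\<^sup>+ x. ennreal (\<eta> (t, x) powr b) \<partial>lborel) \<le> ennreal V * indicator {- real k .. real k} t" for t
    proof -
      have "ennreal (\<eta> (t, x) powr b) \<le> ennreal (real k powr b) * indicator {- real k .. real k} t * indicator (cball 0 (real k)) x" for x
      proof (cases "norm (t, x) \<le> real k")
        case True
        then have "\<bar>t\<bar> \<le> real k" "norm x \<le> real k"
          using norm_fst_le[of t x] norm_snd_le[of x t] by auto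
        then have "t \<in> {- real k .. real k}" "x \<in> cball 0 (real k)"
          by auto
        then show ?thesis
          using b \<eta>_le[of "(t, x)"] \<eta>_nonneg[of "(t, x)"] by (simp add: powr_mono2 ennreal_leI)
      next
        case False
        then show ?thesis using \<eta>_0[of "(t, x)"] by simp
      qed
      then have "(\<integral>\<^sup>+ x. ennreal (\<eta> (t, x) powr b) \<partial>lborel)
          \<le> (\<integral>\<^sup>+ x. ennreal (real k powr b) * indicator {- real k .. real k} t * indicator (cball 0 (real k) :: 'a set) x \<partial>lborel)"
        by (rule nn_integral_mono)
      also have "\<dots> = ennreal (real k powr b) * indicator {- real k .. real k} t * emeasure lborel (cball 0 (real k) :: 'a set)"
        by (rule nn_integral_cmult_indicator) simp
      also have "emeasure lborel (cball 0 (real k) :: 'a set) = ennreal (measure lborel (cball 0 (real k) :: 'a set))"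
        by (rule emeasure_eq_ennreal_measure) (use emeasure_bounded_finite[of "cball 0 (real k) :: 'a set"] in auto)
      also have "ennreal (real k powr b) * indicator {- real k .. real k} t * \<dots> = ennreal V * indicator {- real k .. real k} t"
        by (simp add: V_def ennreal_mult mult_ac)
      finally show ?thesis .
    qed
    have B_nonneg: "B t \<ge> 0" for t by (simp add: B_def)
    have B_eq: "(\<integral>\<^sup>+ x. ennreal (\<eta> (t, x) powr b) \<partial>lborel) = ennreal (B t)" for t
    proof -
      have "ennreal V * indicator {- real k .. real k} t < top"
        by (simp add: indicator_def)
      then show ?thesis
        using bound[of t] by (simp add: B_def)
    qed
    have [measurable]: "B \<in> borel_measurable borel"
      unfolding B_def by measurable
    have B_le: "B t powr ((D - 1) / D) \<le> V powr ((D - 1) / D) * indicator {- real k .. real k} t" for t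
    proof (cases "t \<in> {- real k .. real k}")
      case True
      then have "B t \<le> V"
        using bound[of t] V by (simp add: B_eq)
      then show ?thesis
        using D B_nonneg[of t] True by (simp add: powr_mono2)
    next
      case False
      then have "B t \<le> 0"
        using bound[of t] by (simp add: B_eq ennreal_eq_0_iff)
      then show ?thesis
        using B_nonneg[of t] False by simp
    qed
    define g where "g = (\<lambda>p. \<eta> p powr (2 / (real DIM('a) - 1)) * B (fst p) powr (- 1 / real DIM('a)))"
    have g [measurable]: "g \<in> borel_measurable borel"
      unfolding g_def by measurable
    have g_nonneg: "g p \<ge> 0" for p by (simp add: g_def)
    define I where "I = (\<integral>\<^sup>+ t. ennreal (B t powr ((D - 1) / D)) \<partial>lborel)"
    have energy: "dual_energy g = I"
      unfolding g_def I_def D_def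
      by (rule dual_test_function(1)[OF \<eta> \<eta>_nonneg _ B_nonneg B_eq[unfolded b_def D_def] dim]) measurable
    have pairing: "(\<integral>\<^sup>+ t. (\<integral>\<^sup>+ x. ennreal (\<eta> (t, x)) * ennreal (g (t, x)) \<partial>lborel) \<partial>lborel) = I"
      unfolding g_def I_def D_def
      by (rule dual_test_function(2)[OF \<eta> \<eta>_nonneg _ B_nonneg B_eq[unfolded b_def D_def] dim]) measurable
    have "I \<le> (\<integral>\<^sup>+ t. ennreal (V powr ((D - 1) / D)) * indicator {- real k .. real k} t \<partial>lborel)"
      unfolding I_def using B_le by (intro nn_integral_mono) (simp add: ennreal_mult'[symmetric] ennreal_indicator[symmetric] ennreal_leI del: ennreal_indicator)
    also have "\<dots> = ennreal (V powr ((D - 1) / D)) * emeasure lborel {- real k .. real k}"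
      by (rule nn_integral_cmult_indicator) simp
    also have "\<dots> < top"
      by (simp add: ennreal_mult_less_top)
    finally obtain A where A: "I = ennreal A" "A \<ge> 0"
      by (metis ennreal_cases less_top)
    have "I \<le> enn_powr c ((D + 1) / D)"
    proof (cases "A = 0 \<or> c = top")
      case True
      then show ?thesis using A by auto
    next
      case False
      then have A_pos: "A > 0" using A by simp
      obtain r where r: "c = ennreal r" "r \<ge> 0"
        using False by (cases c) auto
      have "I \<le> (\<integral>\<^sup>+ t. (\<integral>\<^sup>+ x. \<rho> (t, x) * ennreal (g (t, x)) \<partial>lborel) \<partial>lborel)"
        unfolding pairing[symmetric] trunc[symmetric] by (intro nn_integral_mono mult_right_mono truncation_le) simp
      also have "\<dots> \<le> c * ennreal (A powr (1 / (D + 1)))"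
        unfolding D_def using energy A A_pos by (intro dual g g_nonneg) auto
      finally have "A \<le> r * A powr (1 / (D + 1))"
        using A r by (simp add: ennreal_mult[symmetric])
      moreover have "A = A powr (D / (D + 1)) * A powr (1 / (D + 1))"
      proof -
        have "D + 1 \<noteq> 0" using D by linarith
        then have "D / (D + 1) + 1 / (D + 1) = 1"
          by (simp add: add_divide_distrib[symmetric])
        then show ?thesis
          using A_pos by (simp add: powr_add[symmetric])
      qed
      ultimately have "A powr (D / (D + 1)) * A powr (1 / (D + 1)) \<le> r * A powr (1 / (D + 1))"
        by simp
      then have "A powr (D / (D + 1)) \<le> r"
        using A_pos by simp
      then have "(A powr (D / (D + 1))) powr ((D + 1) / D) \<le> r powr ((D + 1) / D)"
        using D by (intro powr_mono2) auto
      moreover have "(A powr (D / (D + 1))) powr ((D + 1) / D) = A"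
        using A_pos D by (simp add: powr_powr)
      ultimately show ?thesis
        using A r by (simp add: enn_powr_ennreal)
    qed
    moreover have "mixed_power (truncation \<rho> k) = I"
      using B_nonneg \<eta>_nonneg by (simp add: mixed_power_def trunc enn_powr_ennreal B_eq[unfolded b_def D_def] I_def D_def)
    ultimately show ?thesis by simp
  qed
  then have "(SUP k. mixed_power (truncation \<rho> k)) \<le> enn_powr c ((D + 1) / D)"
    by (intro SUP_least)
  then show ?thesis
    by (simp add: SUP_mixed_power_truncation[OF \<rho> dim] D_def)
qed

lemma velocity_average_mixed_power:
  fixes F :: "'a::euclidean_space \<times> 'a \<Rightarrow> real"
  assumes F [measurable]: "F \<in> borel_measurable borel" and F_nonneg: "\<And>z. F z \<ge> 0" and dim: "DIM('a) \<ge> 2"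
  shows "mixed_power (\<lambda>p. \<integral>\<^sup>+ v. ennreal (F (snd p - fst p *\<^sub>R v, v)) \<partial>lborel)
    \<le> enn_powr (ennreal (1 + weak_const (real DIM('a)) / real DIM('a)) * lorentz_integral F)
        ((real DIM('a) + 1) / real DIM('a))"
proof (rule mixed_power_le_by_duality[OF _ dim])
  show "(\<lambda>p. \<integral>\<^sup>+ v. ennreal (F (snd p - fst p *\<^sub>R v, v)) \<partial>lborel) \<in> borel_measurable borel"
    by measurable
  fix g :: "real \<times> 'a \<Rightarrow> real" and A
  assume g: "g \<in> borel_measurable borel" "\<And>p. g p \<ge> 0" "dual_energy g = ennreal A" "A > 0"
  show "(\<integral>\<^sup>+ t. (\<integral>\<^sup>+ x. (\<integral>\<^sup>+ v. ennreal (F (snd (t, x) - fst (t, x) *\<^sub>R v, v)) \<partial>lborel) * ennreal (g (t, x)) \<partial>lborel) \<partial>lborel)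
      \<le> ennreal (1 + weak_const (real DIM('a)) / real DIM('a)) * lorentz_integral F * ennreal (A powr (1 / (real DIM('a) + 1)))"
    using xray_lorentz_dual[OF g(1,2) dim F F_nonneg g(3,4)]
    by (simp add: transport_duality[OF g(1) F] ennreal_mult weak_const_nonneg mult_ac)
qed

section \<open>From Borel functions to Lebesgue measurable functions\<close>

lemma lebesgue_measurable_complex_borel_version:
  fixes f :: "'a::euclidean_space \<Rightarrow> complex"
  assumes "f \<in> borel_measurable lebesgue"
  obtains g where "g \<in> borel_measurable borel" "AE z in lborel. f z = g z"
proof -
  have "(\<lambda>z. Re (f z)) \<in> borel_measurable lebesgue" "(\<lambda>z. Im (f z)) \<in> borel_measurable lebesgue"
    using assms by measurable
  then obtain u v where [measurable]: "u \<in> borel_measurable borel" "v \<in> borel_measurable borel"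
    and uv: "AE z in lborel. Re (f z) = u z" "AE z in lborel. Im (f z) = v z"
    by (auto dest!: completion_ex_borel_measurable_real)
  show thesis
  proof (rule that)
    show "(\<lambda>z. of_real (u z) + \<i> * of_real (v z)) \<in> borel_measurable borel"
      by measurable
    show "AE z in lborel. f z = of_real (u z) + \<i> * of_real (v z)"
      using uv by eventually_elim (simp add: complex_eq_iff)
  qed
qed

text \<open>For each \<open>t\<close> the map \<open>(x, v) \<mapsto> (x - t v, v)\<close> preserves measure.  This lets a function on phase
  space be replaced by a Borel version while its velocity averages change only on a null set.\<close>

lemma transport_null_set:
  fixes N :: "('a::euclidean_space \<times> 'a) set"
  assumes N: "N \<in> null_sets lborel"
  shows "AE x in lborel. AE v in lborel. (x - t *\<^sub>R v, v) \<notin> N"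
    and "AE p in lborel. AE v in lborel. (snd p - fst p *\<^sub>R v, v) \<notin> N"
proof -
  have [measurable]: "N \<in> sets borel"
    using N by auto
  define n where "n p = (\<integral>\<^sup>+ v. indicator N (snd p - fst p *\<^sub>R v, v) \<partial>lborel)" for p :: "real \<times> 'a"
  have n [measurable]: "n \<in> borel_measurable borel"
    unfolding n_def by measurable
  have n_0: "n p = 0 \<longleftrightarrow> (AE v in lborel. (snd p - fst p *\<^sub>R v, v) \<notin> N)" for p
    unfolding n_def by (subst nn_integral_0_iff_AE) (auto simp: indicator_eq_0_iff)
  have int_0: "(\<integral>\<^sup>+ x. n (t, x) \<partial>lborel) = 0" for t
  proof -
    have "(\<integral>\<^sup>+ x. n (t, x) \<partial>lborel) = (\<integral>\<^sup>+ v. (\<integral>\<^sup>+ x. indicator N (x - t *\<^sub>R v, v) \<partial>lborel) \<partial>lborel)"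
      using nn_integral_lborel_swap[of "\<lambda>p. indicator N (fst p - t *\<^sub>R snd p, snd p)"]
      by (simp add: n_def)
    also have "\<dots> = (\<integral>\<^sup>+ v. (\<integral>\<^sup>+ x. indicator N (x, v) \<partial>lborel) \<partial>lborel)"
    proof (rule nn_integral_cong)
      fix v :: 'a
      show "(\<integral>\<^sup>+ x. indicator N (x - t *\<^sub>R v, v) \<partial>lborel) = (\<integral>\<^sup>+ x. indicator N (x, v) \<partial>lborel :: ennreal)"
        using nn_integral_lborel_translate[of "\<lambda>x. indicator N (x, v)" "- (t *\<^sub>R v)"] by simp
    qed
    also have "\<dots> = (\<integral>\<^sup>+ z. indicator N z \<partial>lborel)"
      by (rule nn_integral_lborel_snd[symmetric]) simp
    also have "\<dots> = 0"
      using N by auto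
    finally show ?thesis .
  qed
  have "AE x in lborel. n (t, x) = 0"
    using int_0[of t] by (subst (asm) nn_integral_0_iff_AE) auto
  then show "AE x in lborel. AE v in lborel. (x - t *\<^sub>R v, v) \<notin> N"
    by (simp add: n_0)
  have "(\<integral>\<^sup>+ p. n p \<partial>lborel) = 0"
    by (simp add: nn_integral_lborel_fst int_0)
  then have "AE p in lborel. n p = 0"
    by (subst (asm) nn_integral_0_iff_AE) auto
  then show "AE p in lborel. AE v in lborel. (snd p - fst p *\<^sub>R v, v) \<notin> N"
    by (simp add: n_0)
qed

lemma AE_finite_of_mixed_power:
  fixes \<rho> :: "real \<times> 'a::euclidean_space \<Rightarrow> ennreal"
  assumes \<rho> [measurable]: "\<rho> \<in> borel_measurable borel" and fin: "mixed_power \<rho> < top" and dim: "DIM('a) \<ge> 2"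
  shows "AE p in lborel. \<rho> p < top"
proof -
  define b where "b = (real DIM('a) + 1) / (real DIM('a) - 1)"
  define c where "c = (real DIM('a) - 1) / real DIM('a)"
  have top_iff: "enn_powr x e = top \<longleftrightarrow> x = top" for x e
    by (cases x) (simp_all add: enn_powr_ennreal)
  define S where "S = {p. \<rho> p = top}"
  have [measurable]: "S \<in> sets borel"
    unfolding S_def by measurable
  have "AE t in lborel. enn_powr (\<integral>\<^sup>+ x. enn_powr (\<rho> (t, x)) b \<partial>lborel) c \<noteq> \<infinity>"
    using fin by (intro nn_integral_noteq_infinite) (auto simp: mixed_power_def b_def c_def)
  then have "AE t in lborel. (\<integral>\<^sup>+ x. indicator S (t, x) \<partial>lborel) = 0"
  proof eventually_elim
    case (elim t)
    then have "AE x in lborel. enn_powr (\<rho> (t, x)) b \<noteq> \<infinity>"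
      by (intro nn_integral_noteq_infinite) (auto simp: top_iff)
    then have "AE x in lborel. indicator S (t, x) = (0 :: ennreal)"
      by eventually_elim (simp add: top_iff S_def)
    then show ?case
      by (subst nn_integral_0_iff_AE) auto
  qed
  then have "(\<integral>\<^sup>+ t. (\<integral>\<^sup>+ x. indicator S (t, x) \<partial>lborel) \<partial>lborel) = 0"
    by (subst nn_integral_0_iff_AE) auto
  then have "(\<integral>\<^sup>+ p. indicator S p \<partial>lborel) = 0"
    by (subst nn_integral_lborel_fst) simp_all
  then have "AE p in lborel. indicator S p = (0 :: ennreal)"
    by (subst (asm) nn_integral_0_iff_AE) auto
  then show ?thesis
    by eventually_elim (auto simp: S_def indicator_eq_0_iff less_top)
qed

theorem corollary1p9:
  fixes d :: real
  assumes d_def: "d = real CARD('d::finite)"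
    and d_ge_2: "CARD('d) \<ge> 2"
  shows "\<exists>C::real. 0 \<le> C \<and>
    (\<forall>f0 :: (real^'d) \<times> (real^'d) \<Rightarrow> complex.
       f0 \<in> lorentz_space ((d + 1) / d) 1 lebesgue \<longrightarrow>
         (AE (t, x) in (lebesgue :: (real \<times> (real^'d)) measure).
            integrable lebesgue (\<lambda>v. f0 (x - t *\<^sub>R v, v))) \<and>
         (\<lambda>(t, x). velocity_average f0 t x) \<in> borel_measurable lebesgue \<and>
         mixed_norm ((d + 1) / d) ((d + 1) / (d - 1)) (velocity_average f0)
           \<le> ennreal C * lorentz_norm ((d + 1) / d) 1 lebesgue f0)"
proof -
  have dim: "DIM(real^'d) \<ge> 2" and d_dim: "real DIM(real^'d) = d"
    using d_ge_2 by (simp_all add: d_def)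
  have d: "d \<ge> 2" using d_ge_2 by (simp add: d_def)
  define C where "C = 1 + weak_const d / d"
  have C: "C \<ge> 0" using d by (simp add: C_def weak_const_nonneg)
  show ?thesis
  proof (intro exI[of _ C] conjI C allI impI)
    fix f0 :: "(real^'d) \<times> (real^'d) \<Rightarrow> complex"
    assume f0: "f0 \<in> lorentz_space ((d + 1) / d) 1 lebesgue"
    then have f0_meas: "f0 \<in> borel_measurable lebesgue"
      and f0_fin: "lorentz_norm ((d + 1) / d) 1 lebesgue f0 < top"
      by (simp_all add: lorentz_space_def)
    obtain f1 where f1 [measurable]: "f1 \<in> borel_measurable borel" and f01: "AE z in lborel. f0 z = f1 z"
      using lebesgue_measurable_complex_borel_version[OF f0_meas] .
    (* All statements are reduced to the Borel function f1; the two functions agree off the null set N. *)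
    obtain N where N: "N \<in> null_sets lborel" "\<And>z. z \<notin> N \<Longrightarrow> f0 z = f1 z"
      using f01 by (auto elim!: AE_E3)
    define F where "F z = norm (f1 z)" for z
    have F [measurable]: "F \<in> borel_measurable borel"
      unfolding F_def by measurable
    define \<rho> where "\<rho> p = (\<integral>\<^sup>+ v. ennreal (F (snd p - fst p *\<^sub>R v, v)) \<partial>lborel)" for p :: "real \<times> (real^'d)"
    have \<rho> [measurable]: "\<rho> \<in> borel_measurable borel"
      unfolding \<rho>_def by measurable
    have distr: "distr_fun lebesgue f0 s = emeasure lborel {z. s < F z}" for s
    proof -
      have "emeasure lebesgue {z \<in> space lebesgue. s < norm (f0 z)} = emeasure lebesgue {z. s < F z}"
      proof (rule emeasure_eq_AE)
        show "AE z in lebesgue. z \<in> {z \<in> space lebesgue. s < norm (f0 z)} \<longleftrightarrow> z \<in> {z. s < F z}"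
          using AE_completion[OF f01] by eventually_elim (simp add: F_def)
        show "{z \<in> space lebesgue. s < norm (f0 z)} \<in> sets lebesgue"
          using f0_meas by measurable
        show "{z. s < F z} \<in> sets lebesgue"
          by (rule sets_completionI_sets) simp
      qed
      then show ?thesis by (simp add: distr_fun_def)
    qed
    have lorentz: "lorentz_norm ((d + 1) / d) 1 lebesgue f0 = ennreal ((d + 1) / d) * lorentz_integral F"
    proof -
      have "(\<integral>\<^sup>+ s \<in> {0<..}. (enn_powr (ennreal s * enn_powr (distr_fun lebesgue f0 s) (1 / ((d + 1) / d))) 1 / ennreal s) \<partial>lborel)
          = lorentz_integral F"
        unfolding lorentz_integral_def
      proof (rule nn_integral_cong)
        fix s :: real
        show "enn_powr (ennreal s * enn_powr (distr_fun lebesgue f0 s) (1 / ((d + 1) / d))) 1 / ennreal s * indicator {0<..} s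
          = enn_powr (emeasure lborel {z. s < F z}) (real DIM(real^'d) / (real DIM(real^'d) + 1)) * indicator {0<..} s"
        proof (cases "s > 0")
          case True
          have "ennreal s * x / ennreal s = x" for x
            using True by (subst mult.commute) (simp add: ennreal_mult_divide_eq)
          then show ?thesis
            using True unfolding d_dim by (simp add: distr)
        qed simp
      qed
      then show ?thesis
        using d by (simp add: lorentz_norm_def)
    qed
    (* The normalising constant of the Lorentz norm is at least 1 and can be dropped. *)
    have "lorentz_integral F \<le> ennreal ((d + 1) / d) * lorentz_integral F"
      using d mult_right_mono[of 1 "ennreal ((d + 1) / d)" "lorentz_integral F"] by simp
    then have le_lorentz: "lorentz_integral F \<le> lorentz_norm ((d + 1) / d) 1 lebesgue f0"
      by (simp add: lorentz)
    have mixed: "mixed_power \<rho> \<le> enn_powr (ennreal C * lorentz_integral F) ((d + 1) / d)"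
      using velocity_average_mixed_power[OF F _ dim] unfolding \<rho>_def C_def d_dim by (simp add: F_def)
    have "ennreal C * lorentz_integral F < top"
      using order.strict_trans1[OF le_lorentz f0_fin] by (simp add: ennreal_mult_less_top)
    then have "enn_powr (ennreal C * lorentz_integral F) ((d + 1) / d) < top"
      by (simp add: enn_powr_def)
    with mixed have "mixed_power \<rho> < top"
      by (rule order.strict_trans1)
    then have \<rho>_fin: "AE p in lborel. \<rho> p < top"
      by (intro AE_finite_of_mixed_power \<rho> dim)

    have section_AE: "AE v in lebesgue. f1 (x - t *\<^sub>R v, v) = f0 (x - t *\<^sub>R v, v)"
      if "AE v in lborel. (x - t *\<^sub>R v, v) \<notin> N" for t x
      using that N(2) by (intro AE_completion) (auto elim!: eventually_mono)
    have section_meas: "(\<lambda>v. f1 (x - t *\<^sub>R v, v)) \<in> borel_measurable lebesgue" for t x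
      by (intro measurable_completion) measurable
    have section_meas0: "(\<lambda>v. f0 (x - t *\<^sub>R v, v)) \<in> borel_measurable lebesgue"
      if "AE v in lborel. (x - t *\<^sub>R v, v) \<notin> N" for t x
      by (rule borel_measurable_AE[OF section_meas section_AE[OF that]])
    have avg: "velocity_average f0 t x = (LINT v|lborel. f1 (x - t *\<^sub>R v, v))"
      if "AE v in lborel. (x - t *\<^sub>R v, v) \<notin> N" for t x
    proof -
      have "velocity_average f0 t x = (LINT v|lebesgue. f1 (x - t *\<^sub>R v, v))"
        unfolding velocity_average_def using section_AE[OF that]
        by (intro integral_cong_AE section_meas section_meas0 that) (auto elim!: eventually_mono)
      also have "\<dots> = (LINT v|lborel. f1 (x - t *\<^sub>R v, v))"
        by (rule integral_completion) measurable
      finally show ?thesis .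
    qed

    show "AE (t, x) in lebesgue. integrable lebesgue (\<lambda>v. f0 (x - t *\<^sub>R v, v))"
    proof (rule AE_completion)
      show "AE (t, x) in lborel. integrable lebesgue (\<lambda>v. f0 (x - t *\<^sub>R v, v))"
        using transport_null_set(2)[OF N(1)] \<rho>_fin
      proof eventually_elim
        case (elim p)
        obtain t x where p: "p = (t, x)" by (cases p)
        have null: "AE v in lborel. (x - t *\<^sub>R v, v) \<notin> N"
          using elim(1) by (simp add: p)
        have "integrable lborel (\<lambda>v. f1 (x - t *\<^sub>R v, v))"
          using elim(2) by (intro integrableI_bounded) (auto simp: p \<rho>_def F_def)
        then have "integrable lebesgue (\<lambda>v. f1 (x - t *\<^sub>R v, v))"
          by (subst integrable_completion) measurable
        then have "integrable lebesgue (\<lambda>v. f0 (x - t *\<^sub>R v, v))"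
          using section_AE[OF null] by (rule integrable_cong_AE_imp[OF _ section_meas0[OF null]])
        then show ?case by (simp add: p)
      qed
    qed

    define G where "G p = (LINT v|lborel. f1 (snd p - fst p *\<^sub>R v, v))" for p :: "real \<times> (real^'d)"
    have G [measurable]: "G \<in> borel_measurable borel"
      unfolding G_def by measurable
    show "(\<lambda>(t, x). velocity_average f0 t x) \<in> borel_measurable lebesgue"
    proof (rule borel_measurable_AE)
      show "G \<in> borel_measurable lebesgue"
        by (intro measurable_completion) measurable
      have "AE p in lborel. G p = (case p of (t, x) \<Rightarrow> velocity_average f0 t x)"
        using transport_null_set(2)[OF N(1)]
        by eventually_elim (auto simp: G_def avg)
      then show "AE p in lebesgue. G p = (case p of (t, x) \<Rightarrow> velocity_average f0 t x)"
        by (rule AE_completion)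
    qed

    define b c where "b = (d + 1) / (d - 1)" and "c = (d - 1) / d"
    have b: "b > 0" and c: "c > 0" using d by (auto simp: b_def c_def)
    have exps: "1 / b * ((d + 1) / d) = c"
    proof -
      have "d + 1 \<noteq> 0" using d by linarith
      then show ?thesis by (simp add: b_def c_def)
    qed
    have inner: "(\<integral>\<^sup>+ x. enn_powr (ennreal (norm (velocity_average f0 t x))) b \<partial>lebesgue) \<le> (\<integral>\<^sup>+ x. enn_powr (\<rho> (t, x)) b \<partial>lborel)" for t
    proof -
      have "AE x in lborel. enn_powr (ennreal (norm (velocity_average f0 t x))) b \<le> enn_powr (\<rho> (t, x)) b"
        using transport_null_set(1)[OF N(1), of t]
      proof eventually_elim
        case (elim x)
        have "ennreal (norm (LINT v|lborel. f1 (x - t *\<^sub>R v, v))) \<le> \<rho> (t, x)"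
        proof (cases "integrable lborel (\<lambda>v. f1 (x - t *\<^sub>R v, v))")
          case True
          then show ?thesis
            using integral_norm_bound_ennreal[OF True] by (simp add: \<rho>_def F_def)
        qed (simp add: not_integrable_integral_eq)
        then show ?case
          using b by (simp add: avg[OF elim] enn_powr_mono)
      qed
      then show ?thesis
        unfolding nn_integral_completion by (rule nn_integral_mono_AE)
    qed
    have "mixed_norm ((d + 1) / d) b (velocity_average f0)
        = enn_powr (\<integral>\<^sup>+ t. enn_powr (\<integral>\<^sup>+ x. enn_powr (ennreal (norm (velocity_average f0 t x))) b \<partial>lebesgue) c \<partial>lborel) (1 / ((d + 1) / d))"
      by (simp only: mixed_norm_def Lp_norm_def enn_powr_powr exps nn_integral_completion)
    also have "\<dots> \<le> enn_powr (mixed_power \<rho>) (1 / ((d + 1) / d))"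
      using c d inner unfolding mixed_power_def d_dim b_def[symmetric] c_def[symmetric]
      by (intro enn_powr_mono nn_integral_mono) auto
    also have "\<dots> \<le> enn_powr (enn_powr (ennreal C * lorentz_integral F) ((d + 1) / d)) (1 / ((d + 1) / d))"
      using d mixed by (intro enn_powr_mono) auto
    also have "\<dots> = ennreal C * lorentz_integral F"
    proof -
      have "(d + 1) / d * (1 / ((d + 1) / d)) = 1"
        using d by simp
      then show ?thesis by (simp only: enn_powr_powr enn_powr_one)
    qed
    also have "\<dots> \<le> ennreal C * lorentz_norm ((d + 1) / d) 1 lebesgue f0"
      by (intro mult_left_mono le_lorentz) simp
    finally show "mixed_norm ((d + 1) / d) ((d + 1) / (d - 1)) (velocity_average f0)
        \<le> ennreal C * lorentz_norm ((d + 1) / d) 1 lebesgue f0"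
      by (simp add: b_def)
  qed
qed

end
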